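(* Let $\Omega$, $\beta$, $r=1/\beta$ satisfy the curvature assumption $r<r_0/2$, let $\Phi$ be a polynomial in momenta integral of the magnetic billiard flow in $\Omega$, and let $F:\Omega_r\to\mathbb{R}$ be the function defined by $F\circ\mathcal{L}=\Phi$. Then $F$ is $C^\infty$-smooth on $\overline{\Omega_r}$ (up to the boundary).
   Context: $\Omega\subset\mathbb{R}^2$ is a bounded domain with boundary $\gamma$ a simple closed $C^\infty$ curve parametrized counterclockwise by arc length $s$; $J$ is the counterclockwise rotation by $\pi/2$, $n=J\dot\gamma$, $\gamma_t=\gamma+t\,n$ is the parallel curve, and $r_0$ is the largest radius for which the tubular neighbourhood of $\gamma$ is diffeomorphic to its normal bundle. Magnetic billiard: a particle moves in $\Omega$ with unit speed along arcs of circles of radius $r$ traversed counterclockwise (Larmor arcs), reflected at $\gamma$ by $v\mapsto v-2\langle n,v\rangle n$; $g^t$ is the flow on unit tangent vectors. $\Omega_+$ is the closed annulus bounded by $\gamma$ and $\gamma_{+2r}$ (swept by the Larmor arcs inside $\Omega$ which intersect $\partial\Omega$). A polynomial in momenta integral is $\Phi(x,v)=\sum_{0\le k+l\le N}a_{kl}(x)v_1^kv_2^l$ on unit tangent vectors over $\Omega_+$, $a_{kl}\in C^\infty(\overline{\Omega_+})$, such that (1) $\Phi(g^t(x,v))=\Phi(x,v)$ between collisions for $x\in\gamma$, $v$ inward unit, and (2) $\Phi(x,v)=\Phi(x,v-2\langle n,v\rangle n)$ for $x\in\partial\Omega$. $\Omega_r$ is the annulus bounded by $\gamma_{+r}$ and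 $\gamma_{-r}$; it is the set of centers of circles of radius $r$ intersecting $\gamma$. The map $\mathcal{L}(x,v)=x+rJv$ assigns to a unit vector tangent to a counterclockwise Larmor circle its center. Since $\Phi$ is constant along Larmor arcs, $F$ is well defined on $\Omega_r$ by $F(x+rJv)=\Phi(x,v)$ for unit vectors $(x,v)$ tangent to Larmor arcs inside $\Omega$ intersecting $\partial\Omega$. *)

theory Defs
  imports "HOL-Complex_Analysis.Winding_Numbers"
begin

text \<open>The plane R^2 is modelled by the type complex; J (rotation by pi/2) is multiplication
by the imaginary unit; the Euclidean inner product is the inner product on complex.\<close>

definition smooth_curve :: "(real \<Rightarrow> complex) \<Rightarrow> bool" where
  "smooth_curve g \<longleftrightarrow> (\<exists>D :: nat \<Rightarrow> real \<Rightarrow> complex. D 0 = g \<and>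
      (\<forall>k t. (D k has_vector_derivative D (Suc k) t) (at t)))"

text \<open>C-infinity real functions on an open set U of the plane: D ds is the iterated partial
derivative along the list ds of directions (False = e1 = 1, True = e2 = i); each is
Frechet differentiable with the expected partials.\<close>
definition smooth_on_open :: "complex set \<Rightarrow> (complex \<Rightarrow> real) \<Rightarrow> bool" where
  "smooth_on_open U f \<longleftrightarrow> open U \<and> (\<exists>D :: bool list \<Rightarrow> complex \<Rightarrow> real.
      (\<forall>x\<in>U. D [] x = f x) \<and>
      (\<forall>ds. \<forall>x\<in>U. (D ds has_derivative
           (\<lambda>h. Re h * D (False # ds) x + Im h * D (True # ds) x)) (at x)))"

definition smooth_upto :: "complex set \<Rightarrow> (complex \<Rightarrow> real) \<Rightarrow> bool" where
  "smooth_upto S f \<longleftrightarrow> (\<exists>U g. S \<subseteq> U \<and> smooth_on_open U g \<and> (\<forall>x\<in>S. g x = f x))"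

definition normal :: "(real \<Rightarrow> complex) \<Rightarrow> real \<Rightarrow> complex" where
  "normal g s = \<i> * vector_derivative g (at s)"

definition tube :: "(real \<Rightarrow> complex) \<Rightarrow> real \<times> real \<Rightarrow> complex" where
  "tube g = (\<lambda>(s,t). g s + of_real t * normal g s)"

text \<open>The normal bundle of radius rho (over the circle R/LZ) is mapped diffeomorphically
onto the tubular neighbourhood: injective and a local diffeomorphism (invertible differential).\<close>
definition tube_diffeo :: "(real \<Rightarrow> complex) \<Rightarrow> real \<Rightarrow> real \<Rightarrow> bool" where
  "tube_diffeo g L \<rho> \<longleftrightarrow>
     inj_on (tube g) ({0..<L} \<times> {-\<rho><..<\<rho>}) \<and>
     (\<forall>s t. \<bar>t\<bar> < \<rho> \<longrightarrow> (\<exists>T. (tube g has_derivative T) (at (s,t)) \<and> inj T))"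

definition tube_radius :: "(real \<Rightarrow> complex) \<Rightarrow> real \<Rightarrow> real" where
  "tube_radius g L = Sup {\<rho>. \<rho> > 0 \<and> tube_diffeo g L \<rho>}"

definition arclength_simple_closed :: "(real \<Rightarrow> complex) \<Rightarrow> real \<Rightarrow> bool" where
  "arclength_simple_closed g L \<longleftrightarrow> L > 0 \<and> smooth_curve g \<and>
     (\<forall>s. g (s + L) = g s) \<and> inj_on g {0..<L} \<and>
     (\<forall>s. norm (vector_derivative g (at s)) = 1)"

definition Omega_r :: "(real \<Rightarrow> complex) \<Rightarrow> real \<Rightarrow> complex set" where
  "Omega_r g r = tube g ` (UNIV \<times> {-r..r})"

definition Omega_plus :: "(real \<Rightarrow> complex) \<Rightarrow> real \<Rightarrow> complex set" where
  "Omega_plus g r = tube g ` (UNIV \<times> {0..2*r})"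

definition larmor_pos :: "real \<Rightarrow> complex \<Rightarrow> complex \<Rightarrow> real \<Rightarrow> complex" where
  "larmor_pos r x v \<tau> = (x + of_real r * \<i> * v) - of_real r * \<i> * v * cis (\<tau> / r)"

definition larmor_vel :: "real \<Rightarrow> complex \<Rightarrow> complex \<Rightarrow> real \<Rightarrow> complex" where
  "larmor_vel r x v \<tau> = v * cis (\<tau> / r)"

definition poly_momenta_integral ::
  "(real \<Rightarrow> complex) \<Rightarrow> real \<Rightarrow> complex set \<Rightarrow> real \<Rightarrow> (complex \<Rightarrow> complex \<Rightarrow> real) \<Rightarrow> bool" where
  "poly_momenta_integral g L \<Omega> r \<Phi> \<longleftrightarrow>
     (\<exists>(N::nat) (a :: nat \<Rightarrow> nat \<Rightarrow> complex \<Rightarrow> real).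
        (\<forall>k l. smooth_upto (Omega_plus g r) (a k l)) \<and>
        (\<forall>x\<in>Omega_plus g r. \<forall>v. norm v = 1 \<longrightarrow>
            \<Phi> x v = (\<Sum>k\<le>N. \<Sum>l\<le>N - k. a k l x * Re v ^ k * Im v ^ l))) \<and>
     (\<forall>s v t. norm v = 1 \<and> inner (normal g s) v > 0 \<and> t > 0 \<and>
        (\<forall>\<tau>\<in>{0<..<t}. larmor_pos r (g s) v \<tau> \<in> \<Omega>) \<longrightarrow>
        (\<forall>\<tau>\<in>{0..t}. \<Phi> (larmor_pos r (g s) v \<tau>) (larmor_vel r (g s) v \<tau>) = \<Phi> (g s) v)) \<and>
     (\<forall>s v. norm v = 1 \<longrightarrow>
        \<Phi> (g s) v = \<Phi> (g s) (v - 2 * of_real (inner (normal g s) v) * normal g s))"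

end

(* The circle of radius r centred at gamma(s) + t n(s), |t| <= r, passes through
   x = gamma(s) + (t + r) n(s), which lies in Omega_+ (up to its boundary), with velocity -gamma'(s).
   So F(gamma(s) + t n(s)) = Phi(x, -gamma'(s)) is a polynomial in gamma'(s) with coefficients
   a_kl(gamma(s) + (t + r) n(s)), which are smooth on a neighbourhood of |t| <= r. Since 2r is below
   the tubular radius, (s, t) are smooth coordinates near the closed annulus, and F is smooth
   up to its boundary. *)

theory Submission
  imports Defs "HOL-Library.Periodic_Fun"
begin

section \<open>Algebras of functions closed under partial derivatives\<close>

text \<open>The hypothesis on \<open>F\<close> speaks only about base points in
  \<open>closure \<Omega>\<close> and circles that meet the curve, so both conditions have to be
  proved at every centre. The circle meets the curve because a curve lying strictly closer than r to
  the centre would have its nearest and farthest points at the same foot, by uniqueness of tube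
  coordinates. That the positive normal points into \<open>\<Omega>\<close> is where the
  counterclockwise orientation enters: the winding number is larger on the left of the curve than on
  the right, shown by comparing two integrals with a Poisson kernel near one single point of the
  curve. Smoothness here means an explicit tree of iterated partials, and the tube map has no global
  inverse because s is periodic; both are handled by an algebra of functions of (s, t), periodic in
  s, that is closed under differentiation in the plane.\<close>

definition has_partials_on ::
  "complex set \<Rightarrow> (complex \<Rightarrow> real) \<Rightarrow> (complex \<Rightarrow> real) \<Rightarrow> (complex \<Rightarrow> real) \<Rightarrow> bool" where
  "has_partials_on U f p q \<longleftrightarrow>
     (\<forall>x\<in>U. (f has_derivative (\<lambda>h. Re h * p x + Im h * q x)) (at x))"

text \<open>The tree of iterated partials demanded by \<open>smooth_on_open\<close> is grown by
  recursion on the list of directions: choice functions pick the partials inside the family, so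
  closure under a single differentiation is enough.\<close>

lemma smooth_on_openI:
  assumes "open U" and "f \<in> \<F>"
    and closed: "\<And>h. h \<in> \<F> \<Longrightarrow> \<exists>p\<in>\<F>. \<exists>q\<in>\<F>. has_partials_on U h p q"
  shows "smooth_on_open U f"
proof -
  obtain P Q where PQ: "\<And>h. h \<in> \<F> \<Longrightarrow> P h \<in> \<F> \<and> Q h \<in> \<F> \<and> has_partials_on U h (P h) (Q h)"
    using closed by metis
  define D where "D = rec_list f (\<lambda>b ds h. if b then Q h else P h)"
  have D_simps: "D [] = f" "D (b # ds) = (if b then Q (D ds) else P (D ds))" for b ds
    by (simp_all add: D_def)
  have mem: "D ds \<in> \<F>" for ds
    by (induction ds) (use assms(2) PQ in \<open>auto simp: D_simps\<close>)
  have "(D ds has_derivative (\<lambda>h. Re h * D (False # ds) x + Im h * D (True # ds) x)) (at x)"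
    if "x \<in> U" for ds x
    using PQ[OF mem[of ds]] that by (simp add: D_simps has_partials_on_def)
  then show ?thesis
    unfolding smooth_on_open_def using \<open>open U\<close> D_simps(1) by (intro conjI exI[of _ D]) auto
qed

text \<open>Generated inductively so that closure under partials and periodicity need checking on
  the generators alone.\<close>

inductive_set fun_alg :: "(complex \<Rightarrow> real) set \<Rightarrow> (complex \<Rightarrow> real) set" for G where
  gen: "f \<in> G \<Longrightarrow> f \<in> fun_alg G"
| const: "(\<lambda>_. c) \<in> fun_alg G"
| add: "f \<in> fun_alg G \<Longrightarrow> h \<in> fun_alg G \<Longrightarrow> (\<lambda>x. f x + h x) \<in> fun_alg G"
| mult: "f \<in> fun_alg G \<Longrightarrow> h \<in> fun_alg G \<Longrightarrow> (\<lambda>x. f x * h x) \<in> fun_alg G"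

lemma fun_alg_uminus: "f \<in> fun_alg G \<Longrightarrow> (\<lambda>x. - f x) \<in> fun_alg G"
  using fun_alg.mult[OF fun_alg.const[of "-1"]] by simp

lemma fun_alg_diff:
  "f \<in> fun_alg G \<Longrightarrow> h \<in> fun_alg G \<Longrightarrow> (\<lambda>x. f x - h x) \<in> fun_alg G"
  using fun_alg.add[OF _ fun_alg_uminus] by fastforce

lemma fun_alg_power: "f \<in> fun_alg G \<Longrightarrow> (\<lambda>x. f x ^ n) \<in> fun_alg G"
  by (induction n) (auto intro: fun_alg.intros)

lemma fun_alg_sum:
  "(\<And>i. i \<in> I \<Longrightarrow> f i \<in> fun_alg G) \<Longrightarrow> (\<lambda>x. \<Sum>i\<in>I. f i x) \<in> fun_alg G"
  by (induction I rule: infinite_finite_induct) (auto intro: fun_alg.intros)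

lemmas fun_alg_intros =
  fun_alg.const fun_alg.add fun_alg.mult fun_alg_uminus fun_alg_diff fun_alg_power fun_alg_sum

lemma fun_alg_partials:
  assumes "f \<in> fun_alg G"
    and "\<And>f. f \<in> G \<Longrightarrow> \<exists>p\<in>fun_alg G. \<exists>q\<in>fun_alg G. has_partials_on U f p q"
  shows "\<exists>p\<in>fun_alg G. \<exists>q\<in>fun_alg G. has_partials_on U f p q"
  using assms(1)
proof induction
  case (gen f)
  then show ?case using assms(2) by blast
next
  case (const c)
  show ?case
    by (rule bexI[of _ "\<lambda>_. 0"], rule bexI[of _ "\<lambda>_. 0"])
       (auto simp: has_partials_on_def intro: fun_alg.const)
next
  case (add f h)
  then obtain p q p' q' where mem: "p \<in> fun_alg G" "q \<in> fun_alg G" "p' \<in> fun_alg G" "q' \<in> fun_alg G"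
    and der: "has_partials_on U f p q" "has_partials_on U h p' q'" by blast
  have "has_partials_on U (\<lambda>x. f x + h x) (\<lambda>x. p x + p' x) (\<lambda>x. q x + q' x)"
    unfolding has_partials_on_def
  proof
    fix x assume "x \<in> U"
    then show "((\<lambda>x. f x + h x) has_derivative
        (\<lambda>k. Re k * (p x + p' x) + Im k * (q x + q' x))) (at x)"
      using der unfolding has_partials_on_def
      by (auto intro!: has_derivative_eq_rhs[OF has_derivative_add] simp: fun_eq_iff algebra_simps)
  qed
  then show ?case using fun_alg.add[OF mem(1,3)] fun_alg.add[OF mem(2,4)] by blast
next
  case (mult f h)
  then obtain p q p' q' where mem: "p \<in> fun_alg G" "q \<in> fun_alg G" "p' \<in> fun_alg G" "q' \<in> fun_alg G"
    and der: "has_partials_on U f p q" "has_partials_on U h p' q'" by blast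
  have "has_partials_on U (\<lambda>x. f x * h x)
      (\<lambda>x. f x * p' x + p x * h x) (\<lambda>x. f x * q' x + q x * h x)"
    unfolding has_partials_on_def
  proof
    fix x assume "x \<in> U"
    then show "((\<lambda>x. f x * h x) has_derivative
        (\<lambda>k. Re k * (f x * p' x + p x * h x) + Im k * (f x * q' x + q x * h x))) (at x)"
      using der unfolding has_partials_on_def
      by (auto intro!: has_derivative_eq_rhs[OF has_derivative_mult] simp: fun_eq_iff algebra_simps)
  qed
  moreover have "(\<lambda>x. f x * p' x + p x * h x) \<in> fun_alg G"
    "(\<lambda>x. f x * q' x + q x * h x) \<in> fun_alg G"
    using mem mult.hyps by (auto intro: fun_alg.add fun_alg.mult)
  ultimately show ?case by blast
qed

section \<open>Closed curves and their tubes\<close>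

locale closed_curve =
  fixes g :: "real \<Rightarrow> complex" and L :: real and D :: "nat \<Rightarrow> real \<Rightarrow> complex"
  assumes L_pos: "L > 0"
    and D_0: "D 0 = g"
    and D_deriv: "\<And>k t. (D k has_vector_derivative D (Suc k) t) (at t)"
    and periodic: "\<And>s. g (s + L) = g s"
    and inj: "inj_on g {0..<L}"
    and unit: "\<And>s. norm (D (Suc 0) s) = 1"
begin

text \<open>Signed curvature with respect to the left normal: for the unit tangent T, the derivative
  T' is i times the curvature times T.\<close>

definition curvature :: "real \<Rightarrow> real" where
  "curvature s = Im (D (Suc (Suc 0)) s * cnj (D (Suc 0) s))"

text \<open>With domain and codomain of the same type, invariance of domain and partials in the
  plane apply directly. Throughout, w = s + i t.\<close>

definition tubec :: "complex \<Rightarrow> complex" where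
  "tubec w = tube g (Re w, Im w)"

lemma g_deriv: "(g has_vector_derivative D (Suc 0) t) (at t)"
  using D_deriv[of 0 t] by (simp add: D_0)

lemma normal_eq: "normal g s = \<i> * D (Suc 0) s"
  unfolding normal_def using g_deriv by (simp add: vector_derivative_at)

lemma tube_eq: "tube g (s, t) = g s + \<i> * of_real t * D (Suc 0) s"
  by (simp add: tube_def normal_eq)

lemma tubec_eq: "tubec w = g (Re w) + \<i> * of_real (Im w) * D (Suc 0) (Re w)"
  by (simp add: tubec_def tube_eq)

lemma D_cont: "continuous_on A (D k)"
  by (meson D_deriv continuous_at_imp_continuous_on has_vector_derivative_continuous)

lemma g_cont: "continuous_on A g"
  using D_cont[of A 0] by (simp add: D_0)

lemma D_periodic: "D k (s + L) = D k s"
proof (induction k arbitrary: s)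
  case 0
  show ?case by (simp add: D_0 periodic)
next
  case (Suc k)
  have "((D k \<circ> (\<lambda>s. s + L)) has_vector_derivative (1 *\<^sub>R D (Suc k) (s + L))) (at s)"
    by (rule vector_diff_chain_at) (auto intro!: derivative_eq_intros D_deriv)
  moreover have "D k \<circ> (\<lambda>s. s + L) = D k"
    using Suc by auto
  ultimately show ?case
    using D_deriv[of k s] vector_derivative_unique_at by fastforce
qed

lemma D_periodic_int: "D k (s + of_int m * L) = D k s"
proof -
  interpret periodic_fun_simple "D k" L
    by standard (rule D_periodic)
  show ?thesis by (rule plus_of_int)
qed

lemma g_periodic_int: "g (s + of_int m * L) = g s"
  using D_periodic_int[of 0] by (simp add: D_0)

lemma reduce_period: obtains m :: int where "s + of_int m * L \<in> {0..<L}"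
proof -
  have "of_int \<lfloor>s / L\<rfloor> * L \<le> s" "s < (of_int \<lfloor>s / L\<rfloor> + 1) * L"
    using L_pos floor_divide_lower floor_divide_upper by blast+
  then show ?thesis
    by (intro that[of "- \<lfloor>s / L\<rfloor>"]) (simp add: algebra_simps)
qed

lemma tube_periodic_int: "tube g (s + of_int m * L, t) = tube g (s, t)"
  by (simp add: tube_eq D_periodic_int g_periodic_int)

lemma unit_cnj: "D (Suc 0) s * cnj (D (Suc 0) s) = 1"
  by (simp add: complex_norm_square[symmetric] unit)

text \<open>Differentiating |T|^2 = 1 shows that T' has no tangential part.\<close>

lemma acceleration: "D (Suc (Suc 0)) s = \<i> * of_real (curvature s) * D (Suc 0) s"
proof -
  let ?T = "D (Suc 0)" and ?A = "D (Suc (Suc 0)) s"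
  have "((\<lambda>s. inner (?T s) (?T s)) has_vector_derivative (inner (?T s) ?A + inner ?A (?T s))) (at s)"
    by (rule bounded_bilinear.has_vector_derivative[OF bounded_bilinear_inner]) (rule D_deriv)+
  moreover have "(\<lambda>s. inner (?T s) (?T s)) = (\<lambda>s. 1)"
    by (simp add: dot_square_norm unit)
  ultimately have "inner (?T s) ?A + inner ?A (?T s) = 0"
    by (metis has_vector_derivative_const vector_derivative_unique_at)
  then have "Re (?A * cnj (?T s)) = 0"
    by (simp add: inner_complex_def algebra_simps)
  then have "?A * cnj (?T s) = \<i> * of_real (curvature s)"
    by (simp add: complex_eq_iff curvature_def)
  then have "?A * (?T s * cnj (?T s)) = \<i> * of_real (curvature s) * ?T s"
    by (simp add: algebra_simps)
  then show ?thesis by (simp add: unit_cnj)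
qed

lemma D_Re_deriv:
  "((\<lambda>w. D k (Re w)) has_derivative (\<lambda>h. Re h *\<^sub>R D (Suc k) (Re w))) (at w)"
  using has_derivative_compose[OF bounded_linear_imp_has_derivative[OF bounded_linear_Re]
      D_deriv[unfolded has_vector_derivative_def, of k "Re w"]] by simp

text \<open>In the frame (T, i T) the differential is diagonal: by \<open>acceleration\<close> the
  s-derivative of g + i t T is (1 - t curvature) T, and the t-derivative is i T.\<close>

lemma tubec_deriv:
  "(tubec has_derivative
     (\<lambda>h. D (Suc 0) (Re w) * Complex (Re h * (1 - Im w * curvature (Re w))) (Im h))) (at w)"
proof -
  have eq: "tubec = (\<lambda>w. D 0 (Re w) + \<i> * of_real (Im w) * D (Suc 0) (Re w))"
    by (simp add: fun_eq_iff tubec_eq D_0)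
  show ?thesis
    unfolding eq
    by (rule has_derivative_eq_rhs[OF has_derivative_add[OF D_Re_deriv
          has_derivative_mult[OF has_derivative_mult[OF has_derivative_const
            has_derivative_of_real[OF bounded_linear_imp_has_derivative[OF bounded_linear_Im]]]
          D_Re_deriv]]])
      (simp add: fun_eq_iff acceleration complex_eq_iff algebra_simps)
qed

lemma tubec_cont: "continuous_on A tubec"
  using tubec_deriv by (meson continuous_at_imp_continuous_on has_derivative_continuous)

lemma tube_conv_tubec: "tube g = tubec \<circ> (\<lambda>p. Complex (fst p) (snd p))"
  by (simp add: tubec_def fun_eq_iff)

lemma tube_deriv:
  "(tube g has_derivative
     (\<lambda>p. D (Suc 0) s * Complex (fst p * (1 - t * curvature s)) (snd p))) (at (s, t))"
proof -
  have "((\<lambda>p :: real \<times> real. of_real (fst p) + \<i> * of_real (snd p)) has_derivative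
      (\<lambda>p. of_real (fst p) + \<i> * of_real (snd p))) (at (s, t))"
    by (auto intro!: derivative_eq_intros)
  then have "((\<lambda>p :: real \<times> real. Complex (fst p) (snd p)) has_derivative
      (\<lambda>p. Complex (fst p) (snd p))) (at (s, t))"
    by (simp add: Complex_eq)
  from diff_chain_at[OF this tubec_deriv] show ?thesis
    by (simp add: tube_conv_tubec o_def)
qed

text \<open>A derivative is unique, so invertibility is a condition on the tangential diagonal entry
  alone.\<close>

lemma tube_diffeo_iff:
  "tube_diffeo g L \<rho> \<longleftrightarrow> inj_on (tube g) ({0..<L} \<times> {-\<rho><..<\<rho>}) \<and>
     (\<forall>s t. \<bar>t\<bar> < \<rho> \<longrightarrow> 1 - t * curvature s \<noteq> 0)"
proof -
  have "(\<exists>T. (tube g has_derivative T) (at (s, t)) \<and> inj T) \<longleftrightarrow> 1 - t * curvature s \<noteq> 0"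
    (is "?l \<longleftrightarrow> ?r") for s t
  proof -
    let ?T = "\<lambda>p. D (Suc 0) s * Complex (fst p * (1 - t * curvature s)) (snd p)"
    have D_nz: "D (Suc 0) s \<noteq> 0" using unit[of s] by auto
    have "?l \<longleftrightarrow> inj ?T"
      using tube_deriv[of s t] has_derivative_unique by blast
    also have "\<dots> \<longleftrightarrow> ?r"
    proof
      assume *: "inj ?T"
      show ?r
      proof
        assume "1 - t * curvature s = 0"
        then have "?T (1, 0) = ?T (0, 0)" by simp
        with injD[OF *, of "(1, 0)" "(0, 0)"] show False by simp
      qed
    next
      assume ?r
      then show "inj ?T"
        using D_nz by (auto simp: inj_def)
    qed
    finally show ?thesis .
  qed
  then show ?thesis unfolding tube_diffeo_def by blast
qed

end

section \<open>Existence of a tube of positive radius\<close>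

lemma norm_diff_le_vector_derivative:
  fixes f :: "real \<Rightarrow> 'a::real_normed_vector"
  assumes "\<And>x. x \<in> closed_segment a b \<Longrightarrow> (f has_vector_derivative f' x) (at x)"
    and "\<And>x. x \<in> closed_segment a b \<Longrightarrow> norm (f' x) \<le> B"
  shows "norm (f b - f a) \<le> B * \<bar>b - a\<bar>"
proof -
  have "norm (f b - f a) \<le> B * norm (b - a)"
  proof (rule differentiable_bound[of "closed_segment a b"])
    show "(f has_derivative (\<lambda>h. h *\<^sub>R f' x)) (at x within closed_segment a b)"
      if "x \<in> closed_segment a b" for x
      using assms(1)[OF that] unfolding has_vector_derivative_def
      by (rule has_derivative_at_withinI)
    show "onorm (\<lambda>h. h *\<^sub>R f' x) \<le> B" if "x \<in> closed_segment a b" for x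
      using assms(2)[OF that] by (intro onorm_le) (simp add: mult.commute[of B] mult_left_mono)
  qed auto
  then show ?thesis by simp
qed

context closed_curve
begin

lemma g_eqD: assumes "g s = g s'" obtains m :: int where "s' = s + of_int m * L"
proof -
  obtain k where k: "s + of_int k * L \<in> {0..<L}" by (rule reduce_period)
  obtain l where l: "s' + of_int l * L \<in> {0..<L}" by (rule reduce_period)
  have "s + of_int k * L = s' + of_int l * L"
    using inj_onD[OF inj _ k l] assms by (simp add: g_periodic_int)
  then show thesis by (intro that[of "k - l"]) (simp add: algebra_simps)
qed

lemma g_neq: assumes "0 < \<bar>s' - s\<bar>" "\<bar>s' - s\<bar> < L" shows "g s \<noteq> g s'"
proof
  assume "g s = g s'"
  then obtain m :: int where m: "s' = s + of_int m * L" by (rule g_eqD)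
  then have "\<bar>of_int m :: real\<bar> * L < 1 * L" using assms L_pos by (simp add: abs_mult)
  then have "\<bar>of_int m :: real\<bar> < 1" using L_pos by (simp only: mult_less_cancel_right_pos)
  then have "m = 0" by linarith
  then show False using m assms by simp
qed

lemma D_bounded: obtains K where "K > 0" "\<And>s. norm (D k s) \<le> K"
proof -
  have "bounded (D k ` {0..L})"
    by (intro compact_imp_bounded compact_continuous_image D_cont compact_Icc)
  then obtain K where K: "K > 0" "\<And>s. s \<in> {0..L} \<Longrightarrow> norm (D k s) \<le> K"
    by (auto simp: bounded_pos)
  have "norm (D k s) \<le> K" for s
  proof -
    obtain m where m: "s + of_int m * L \<in> {0..<L}" by (rule reduce_period)
    show ?thesis using K(2)[of "s + of_int m * L"] m by (simp add: D_periodic_int)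
  qed
  with K(1) show thesis by (rule that)
qed

lemma tangent_lipschitz:
  assumes "\<And>s. norm (D (Suc (Suc 0)) s) \<le> K"
  shows "norm (D (Suc 0) s' - D (Suc 0) s) \<le> K * \<bar>s' - s\<bar>"
  by (rule norm_diff_le_vector_derivative) (use D_deriv assms in auto)

text \<open>Mean value bound for the map sending u to g(u) - u T(s), whose derivative T(u) - T(s) is
  at most K |s' - s| on the segment. Using this crude maximum is why K stands in place of
  K/2.\<close>

lemma chord_tangent:
  assumes K: "\<And>s. norm (D (Suc (Suc 0)) s) \<le> K"
  shows "norm (g s' - g s - of_real (s' - s) * D (Suc 0) s) \<le> K * (s' - s)\<^sup>2"
proof -
  have K0: "K \<ge> 0" using K[of 0] norm_ge_zero order_trans by blast
  let ?f = "\<lambda>u. g u - of_real u * D (Suc 0) s"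
  have "norm (?f s' - ?f s) \<le> (K * \<bar>s' - s\<bar>) * \<bar>s' - s\<bar>"
  proof (rule norm_diff_le_vector_derivative)
    fix u assume u: "u \<in> closed_segment s s'"
    show "(?f has_vector_derivative (D (Suc 0) u - D (Suc 0) s)) (at u)"
      by (auto intro!: derivative_eq_intros g_deriv)
    have "\<bar>u - s\<bar> \<le> \<bar>s' - s\<bar>" using u by (auto simp: closed_segment_eq_real_ivl split: if_splits)
    then show "norm (D (Suc 0) u - D (Suc 0) s) \<le> K * \<bar>s' - s\<bar>"
      using tangent_lipschitz[OF K] K0 by (meson mult_left_mono order_trans)
  qed
  then show ?thesis by (simp add: algebra_simps power2_eq_square flip: abs_mult)
qed

text \<open>Multiply the equation by \<open>cnj T\<close> and take real parts. The normal terms drop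
  out except for the rotation of T' against T, of size \<rho> K d with d = |s' - s|, while the chord
  contributes d up to K d^2. So d is at most d (K d + \<rho> K), and a factor below 1 forces d =
  0.\<close>

lemma tube_eq_close:
  assumes K: "\<And>s. norm (D (Suc (Suc 0)) s) \<le> K"
    and eq: "tube g (s, t) = tube g (s', t')"
    and t': "\<bar>t'\<bar> \<le> \<rho>" and small: "K * \<bar>s' - s\<bar> + \<rho> * K < 1"
  shows "s = s' \<and> t = t'"
proof -
  let ?T = "D (Suc 0) s" and ?T' = "D (Suc 0) s'" and ?d = "\<bar>s' - s\<bar>"
  have T0: "?T \<noteq> 0" using unit[of s] by auto
  have eq': "g s' - g s = \<i> * of_real t * ?T - \<i> * of_real t' * ?T'"
    using eq by (simp add: tube_eq algebra_simps)
  have "(g s' - g s) * cnj ?T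
      = \<i> * of_real t * (?T * cnj ?T) - \<i> * of_real t' * (?T * cnj ?T)
        - of_real t' * (\<i> * (?T' - ?T) * cnj ?T)"
    unfolding eq' by (simp add: algebra_simps)
  then have "Re ((g s' - g s) * cnj ?T) = - t' * Re (\<i> * (?T' - ?T) * cnj ?T)"
    by (simp add: unit_cnj)
  moreover have "\<bar>Re (\<i> * (?T' - ?T) * cnj ?T)\<bar> \<le> K * ?d"
    using abs_Re_le_cmod[of "\<i> * (?T' - ?T) * cnj ?T"] tangent_lipschitz[OF K, of s' s]
    by (simp add: norm_mult unit del: times_complex.simps)
  ultimately have 1: "\<bar>Re ((g s' - g s) * cnj ?T)\<bar> \<le> \<rho> * (K * ?d)"
    using t' by (simp add: abs_mult del: times_complex.simps) (intro mult_mono; simp)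
  have "(g s' - g s) * cnj ?T - of_real (s' - s)
      = (g s' - g s - of_real (s' - s) * ?T) * cnj ?T"
    using unit_cnj[of s] by (simp add: algebra_simps)
  then have "norm ((g s' - g s) * cnj ?T - of_real (s' - s)) \<le> K * (s' - s)\<^sup>2"
    using chord_tangent[OF K, of s' s] by (simp add: norm_mult unit)
  then have 2: "\<bar>Re ((g s' - g s) * cnj ?T) - (s' - s)\<bar> \<le> K * (s' - s)\<^sup>2"
    using abs_Re_le_cmod[of "(g s' - g s) * cnj ?T - of_real (s' - s)"] by simp
  have "?d \<le> ?d * (K * ?d + \<rho> * K)"
    using 1 2 by (simp add: algebra_simps power2_eq_square)
  then have "?d = 0"
    using small mult_less_cancel_left_pos[of ?d "K * ?d + \<rho> * K" 1] by fastforce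
  then have "s = s'" by simp
  then show ?thesis using eq T0 by (simp add: tube_eq)
qed

text \<open>Needed because the supremum of the empty set of reals is unspecified.\<close>

lemma ex_tube_diffeo: "\<exists>\<rho>>0. tube_diffeo g L \<rho>"
proof -
  obtain K where K0: "K > 0" and K: "\<And>s. norm (D (Suc (Suc 0)) s) \<le> K"
    using D_bounded by blast
  \<comment> \<open>For feet at most \<open>d\<close> apart, both terms in the smallness condition
    of \<open>tube_eq_close\<close> are at most 1/4.\<close>
  define d where "d = 1 / (4 * K)"
  have d: "d > 0" "K * d = 1 / 4" using K0 by (simp_all add: d_def)
  \<comment> \<open>Ordered pairs of parameters at distance at least \<open>d\<close> on the circle
    R/LZ; compactness and injectivity keep their points some \<open>m\<close> apart.\<close>
  define S where "S = {p \<in> {0..L} \<times> {0..L}. d \<le> snd p - fst p \<and> snd p - fst p \<le> L - d}"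
  have "compact S"
  proof -
    have "S = ({0..L} \<times> {0..L}) \<inter> {p. d \<le> snd p - fst p \<and> snd p - fst p \<le> L - d}"
      by (auto simp: S_def)
    then show ?thesis
      by (auto intro!: compact_Int_closed compact_Times closed_Collect_conj closed_Collect_le
          continuous_intros)
  qed
  then have "closed ((\<lambda>p. g (snd p) - g (fst p)) ` S)"
    by (intro compact_imp_closed compact_continuous_image continuous_intros
        continuous_on_compose2[OF g_cont[of UNIV]]) auto
  moreover have "0 \<notin> (\<lambda>p. g (snd p) - g (fst p)) ` S"
    using g_neq d(1) by (fastforce simp: S_def)
  ultimately obtain m where m: "m > 0" "\<And>p. p \<in> S \<Longrightarrow> m \<le> norm (g (snd p) - g (fst p))"
    using separate_point_closed[of "(\<lambda>p. g (snd p) - g (fst p)) ` S" 0] by auto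
  \<comment> \<open>The bound \<open>d\<close> keeps \<open>\<rho> * K\<close> at most 1/4; the
    bound \<open>m / 2\<close> makes two normals shorter than \<open>\<rho>\<close> too short to
    meet from feet \<open>m\<close> apart.\<close>
  define \<rho> where "\<rho> = min d (m / 2)"
  have "\<rho> \<le> d" by (simp add: \<rho>_def)
  then have "K * \<rho> \<le> K * d" using K0 by (intro mult_left_mono) auto
  then have "\<rho> * K \<le> 1 / 4" unfolding d(2) by (simp only: mult.commute)
  moreover have "\<rho> > 0" "2 * \<rho> \<le> m" using d m(1) by (auto simp: \<rho>_def)
  ultimately have \<rho>: "\<rho> > 0" "\<rho> * K \<le> 1 / 4" "2 * \<rho> \<le> m" by blast+
  have *: "s = s' \<and> t = t'" if le: "s \<le> s'" and s: "s \<in> {0..<L}" "s' \<in> {0..<L}"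
    and t: "\<bar>t\<bar> < \<rho>" "\<bar>t'\<bar> < \<rho>" and eq: "tube g (s, t) = tube g (s', t')" for s s' t t'
  proof -
    have "s' - s \<le> d \<or> L - d \<le> s' - s \<or> (s, s') \<in> S"
      using s by (auto simp: S_def)
    then consider "s' - s \<le> d" | "L - d \<le> s' - s" | "(s, s') \<in> S" by blast
    then show ?thesis
    proof cases
      case 1
      have "K * \<bar>s' - s\<bar> \<le> K * d" using 1 le K0 by (intro mult_left_mono) auto
      with \<rho> d have "K * \<bar>s' - s\<bar> + \<rho> * K < 1" by linarith
      then show ?thesis using tube_eq_close[OF K eq, of \<rho>] t by auto
    next
      case 2
      \<comment> \<open>The feet are close across the seam of the period, so one is moved by a full
        period; the resulting s' = s + L is impossible in the half-open interval.\<close>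
      have eq': "tube g (s', t') = tube g (s + L, t)"
        using eq tube_periodic_int[of s 1 t] by simp
      have "K * \<bar>s + L - s'\<bar> \<le> K * d" using 2 s K0 by (intro mult_left_mono) auto
      with \<rho> d have "K * \<bar>s + L - s'\<bar> + \<rho> * K < 1" by linarith
      then have "s' = s + L" using tube_eq_close[OF K eq', of \<rho>] t by auto
      then show ?thesis using s by simp
    next
      case 3
      have "g s' - g s = \<i> * of_real t * D (Suc 0) s - \<i> * of_real t' * D (Suc 0) s'"
        using eq by (simp add: tube_eq algebra_simps)
      then have "norm (g s' - g s) \<le> \<bar>t\<bar> + \<bar>t'\<bar>"
        using norm_triangle_ineq4[of "\<i> * of_real t * D (Suc 0) s" "\<i> * of_real t' * D (Suc 0) s'"]
        by (simp add: norm_mult unit)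
      then show ?thesis using m(2)[OF 3] t \<rho> by simp
    qed
  qed
  have "inj_on (tube g) ({0..<L} \<times> {-\<rho><..<\<rho>})"
  proof (rule inj_onI; clarify)
    fix s t s' t'
    assume "s \<in> {0..<L}" "s' \<in> {0..<L}" "t \<in> {-\<rho><..<\<rho>}" "t' \<in> {-\<rho><..<\<rho>}"
      "tube g (s, t) = tube g (s', t')"
    then show "s = s' \<and> t = t'" using *[of s s' t t'] *[of s' s t' t]
      by (cases "s \<le> s'") (auto simp: abs_less_iff)
  qed
  moreover have "1 - t * curvature s \<noteq> 0" if "\<bar>t\<bar> < \<rho>" for s t
  proof -
    have "\<bar>curvature s\<bar> \<le> K"
      using abs_Im_le_cmod[of "D (Suc (Suc 0)) s * cnj (D (Suc 0) s)"] K[of s]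
      by (simp add: curvature_def norm_mult unit del: times_complex.simps)
    then have "\<bar>t * curvature s\<bar> \<le> \<rho> * K"
      unfolding abs_mult using that by (intro mult_mono) auto
    then show ?thesis using \<rho>(2) by auto
  qed
  ultimately show ?thesis using \<rho>(1) tube_diffeo_iff by blast
qed

lemma tube_radius_gt:
  assumes "x < tube_radius g L" obtains \<rho> where "\<rho> > x" "tube_diffeo g L \<rho>"
proof (cases "bdd_above {\<rho>. \<rho> > 0 \<and> tube_diffeo g L \<rho>}")
  case True
  with assms ex_tube_diffeo show thesis
    unfolding tube_radius_def using less_cSup_iff[of "{\<rho>. \<rho> > 0 \<and> tube_diffeo g L \<rho>}" x]
    by (auto intro: that)
next
  case False
  \<comment> \<open>The supremum of an unbounded set is unspecified, but unboundedness itself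
    supplies a radius beyond \<open>x\<close>.\<close>
  then show thesis using that unfolding bdd_above_def by (metis (mono_tags, lifting) mem_Collect_eq not_le_imp_less)
qed

end

section \<open>Circles centred in the tube meet the curve\<close>

locale tubular_curve = closed_curve +
  fixes \<rho> :: real
  assumes \<rho>_pos: "\<rho> > 0" and diffeo: "tube_diffeo g L \<rho>"
begin

lemma curvature_radius: "\<bar>t\<bar> < \<rho> \<Longrightarrow> 1 - t * curvature s \<noteq> 0"
  using diffeo tube_diffeo_iff by blast

lemma tube_eqD:
  assumes "tube g (s, t) = tube g (s', t')" "\<bar>t\<bar> < \<rho>" "\<bar>t'\<bar> < \<rho>"
  shows "t = t'" "\<exists>m :: int. s' = s + of_int m * L"
proof -
  obtain k where k: "s + of_int k * L \<in> {0..<L}" by (rule reduce_period)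
  obtain l where l: "s' + of_int l * L \<in> {0..<L}" by (rule reduce_period)
  have "inj_on (tube g) ({0..<L} \<times> {-\<rho><..<\<rho>})" using diffeo tube_diffeo_iff by blast
  from inj_onD[OF this, of "(s + of_int k * L, t)" "(s' + of_int l * L, t')"] k l assms
  have "s + of_int k * L = s' + of_int l * L" and "t = t'"
    by (auto simp: tube_periodic_int abs_less_iff)
  then show "t = t'" "\<exists>m :: int. s' = s + of_int m * L"
    by (auto intro!: exI[of _ "k - l"] simp: algebra_simps)
qed

text \<open>At an extremum the vector from the curve to c is orthogonal to the tangent, so c lies on
  the normal line at a. Both normal coordinates of c are below \<open>\<rho>\<close> in modulus,
  where tube coordinates are unique. Minima and maxima are treated alike since only criticality
  matters.\<close>

lemma extremal_distance_foot:
  assumes ext: "(\<forall>u. dist c (g u) \<le> dist c (g a)) \<or> (\<forall>u. dist c (g a) \<le> dist c (g u))"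
    and c: "c = tube g (s, t)" "\<bar>t\<bar> < \<rho>" and a: "dist c (g a) < \<rho>"
  shows "g a = g s \<and> dist c (g a) = \<bar>t\<bar>"
proof -
  let ?T = "D (Suc 0) a"
  let ?f = "\<lambda>u. inner (c - g u) (c - g u)"
  have "((\<lambda>u. c - g u) has_vector_derivative - ?T) (at a)"
    by (auto intro!: derivative_eq_intros g_deriv)
  from bounded_bilinear.has_vector_derivative[OF bounded_bilinear_inner this this]
  have "(?f has_field_derivative (inner (c - g a) (- ?T) + inner (- ?T) (c - g a))) (at a)"
    by (simp add: has_real_derivative_iff_has_vector_derivative)
  moreover have "?f u = (dist c (g u))\<^sup>2" for u by (simp add: dist_norm dot_square_norm)
  ultimately have "inner (c - g a) (- ?T) + inner (- ?T) (c - g a) = 0"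
    using ext DERIV_local_max[of ?f _ a 1] DERIV_local_min[of ?f _ a 1]
    by (smt (verit) power_mono zero_le_dist)
  then have "Re ((c - g a) * cnj ?T) = 0"
    by (simp add: inner_complex_def algebra_simps)
  then have "(c - g a) * cnj ?T = \<i> * of_real (Im ((c - g a) * cnj ?T))"
    by (simp add: complex_eq_iff)
  then obtain \<tau> where "(c - g a) * cnj ?T = \<i> * of_real \<tau>" by blast
  then have "(c - g a) * (?T * cnj ?T) = \<i> * of_real \<tau> * ?T"
    by (metis mult.assoc mult.commute)
  then have eq: "c - g a = \<i> * of_real \<tau> * ?T" by (simp add: unit_cnj)
  then have dist: "dist c (g a) = \<bar>\<tau>\<bar>" by (simp add: dist_norm norm_mult unit)
  have tube: "tube g (s, t) = tube g (a, \<tau>)" using eq c by (simp add: tube_eq algebra_simps)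
  then have "t = \<tau>" "\<exists>m :: int. a = s + of_int m * L"
    using tube_eqD[OF tube] c(2) a dist by auto
  then show ?thesis using dist by (auto simp: g_periodic_int)
qed

text \<open>One point of the curve is at distance |t|, at most r, from the centre; the intermediate
  value theorem needs another at distance at least r. If there were none, every point of the curve
  would be within the range of \<open>extremal_distance_foot\<close>.\<close>

lemma sphere_meets_curve:
  assumes t: "\<bar>t\<bar> \<le> r" and r: "r < \<rho>"
  shows "sphere (tube g (s, t)) r \<inter> range g \<noteq> {}"
proof -
  define c where "c = tube g (s, t)"
  let ?f = "\<lambda>u. dist c (g u)"
  have f_cont: "continuous_on A ?f" for A by (intro continuous_intros g_cont)
  have fs: "?f s = \<bar>t\<bar>" by (simp add: c_def tube_eq dist_norm norm_mult unit)
  have "\<exists>u. r \<le> ?f u"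
  proof (rule ccontr)
    assume "\<nexists>u. r \<le> ?f u"
    then have lt: "?f u < r" for u by (simp add: not_le)
    have per: "\<exists>v\<in>{0..L}. ?f v = ?f u" for u
    proof -
      obtain m where m: "u + of_int m * L \<in> {0..<L}" by (rule reduce_period)
      show ?thesis by (rule bexI[of _ "u + of_int m * L"]) (use m in \<open>auto simp: g_periodic_int\<close>)
    qed
    have ne: "{0..L} \<noteq> {}" using L_pos by simp
    obtain a where "\<And>u. u \<in> {0..L} \<Longrightarrow> ?f u \<le> ?f a"
      using continuous_attains_sup[OF compact_Icc ne f_cont] by blast
    then have a: "?f u \<le> ?f a" for u using per by metis
    obtain b where "\<And>u. u \<in> {0..L} \<Longrightarrow> ?f b \<le> ?f u"
      using continuous_attains_inf[OF compact_Icc ne f_cont] by blast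
    then have b: "?f b \<le> ?f u" for u using per by metis
    have foot: "g u = g s \<and> ?f u = \<bar>t\<bar>"
      if "(\<forall>v. ?f v \<le> ?f u) \<or> (\<forall>v. ?f u \<le> ?f v)" for u
      using extremal_distance_foot[OF that c_def] lt[of u] t r by auto
    have "?f a = \<bar>t\<bar>" "?f b = \<bar>t\<bar>" using foot a b by blast+
    \<comment> \<open>Maximum and minimum of the distance agree, so every parameter is extremal and
      has foot \<open>g s\<close>; the curve would be constant.\<close>
    then have "?f u = \<bar>t\<bar>" for u using a[of u] b[of u] by simp
    then have "g u = g s" for u using foot[of u] by simp
    then have "g 0 = g (L / 2)" by metis
    then show False using g_neq[of 0 "L / 2"] L_pos by simp
  qed
  then obtain u where u: "r \<le> ?f u" by blast
  have "connected (range ?f)" by (intro connected_continuous_image f_cont) auto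
  then have "r \<in> range ?f"
    using connectedD_interval[of "range ?f" "?f s" "?f u" r, OF _ rangeI rangeI] fs t u by auto
  then show ?thesis by (auto simp: c_def)
qed

end

section \<open>The left side of the curve is the inside\<close>

text \<open>The difference from 1/N has numerator at most (1/4 + 1/10) N = 7/20 N and denominator at
  least 3/4 N^2, hence modulus at most 7/(15 N), just below 1/(2 N).\<close>

lemma Re_perturbed_quotient_ge:
  fixes b Q :: complex and N :: real
  assumes "N > 0" "norm b \<le> 1 / 10" "norm (Q - of_real N) \<le> N / 4"
  shows "Re ((1 + b) / Q) \<ge> 1 / (2 * N)"
proof -
  have Q: "norm Q \<ge> 3 / 4 * N"
    using norm_triangle_ineq2[of "of_real N" "of_real N - Q"] assms by (simp add: norm_minus_commute)
  then have "Q \<noteq> 0" using assms by auto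
  then have eq: "(1 + b) / Q - 1 / of_real N = (of_real N - Q + b * of_real N) / (Q * of_real N)"
    using assms by (simp add: field_simps)
  have "norm (of_real N - Q + b * of_real N) \<le> norm (of_real N - Q) + norm (b * of_real N)"
    by (rule norm_triangle_ineq)
  also have "\<dots> \<le> N / 4 + 1 / 10 * N"
    using assms by (intro add_mono) (auto simp: norm_minus_commute norm_mult intro: mult_right_mono)
  finally have num: "norm (of_real N - Q + b * of_real N) \<le> 7 / 20 * N" by simp
  have "norm ((1 + b) / Q - 1 / of_real N) \<le> (7 / 20 * N) / (3 / 4 * N * N)"
    unfolding eq norm_divide norm_mult
    using num Q assms by (intro frac_le mult_mono) (auto intro!: mult_pos_pos simp: norm_mult)
  also have "\<dots> \<le> 1 / (2 * N)" using assms by (simp add: field_simps)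
  finally have "norm ((1 + b) / Q - 1 / of_real N) \<le> 1 / (2 * N)" .
  then have "\<bar>Re ((1 + b) / Q - 1 / of_real N)\<bar> \<le> 1 / (2 * N)"
    using abs_Re_le_cmod order_trans by blast
  moreover have "Re ((1 + b) / Q - 1 / of_real N) = Re ((1 + b) / Q) - 1 / N"
    by (simp only: minus_complex.sel Re_divide_of_real one_complex.sel)
  moreover have "1 / N = 1 / (2 * N) + 1 / (2 * N)" using assms(1) by (simp add: field_simps)
  ultimately show ?thesis by linarith
qed

text \<open>For a straight line, \<Delta> = u T and T' = T, the product is 2 i \<epsilon> / (u^2 +
  \<epsilon>^2), twice the claimed bound. Dividing by T turns the deviations into relative errors of
  size 1/10, which cost at most half.\<close>

lemma Im_jump_kernel_ge:
  fixes T T' \<Delta> :: complex and u \<epsilon> :: real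
  assumes T: "norm T = 1" and T': "norm (T' - T) \<le> 1 / 10"
    and \<Delta>: "norm (\<Delta> - of_real u * T) \<le> \<bar>u\<bar> / 10" and \<epsilon>: "\<epsilon> > 0"
  shows "\<epsilon> / (u\<^sup>2 + \<epsilon>\<^sup>2) \<le>
    Im (T' * (1 / (\<Delta> - \<i> * of_real \<epsilon> * T) - 1 / (\<Delta> + \<i> * of_real \<epsilon> * T)))"
proof -
  define b where "b = (T' - T) / T"
  define E where "E = (\<Delta> - of_real u * T) / T"
  define Q where "Q = (of_real u + E)\<^sup>2 + (of_real \<epsilon>)\<^sup>2"
  define N where "N = u\<^sup>2 + \<epsilon>\<^sup>2"
  have T0: "T \<noteq> 0" using T by auto
  have eqs: "T' = (1 + b) * T" "\<Delta> = (of_real u + E) * T"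
    using T0 by (simp_all add: b_def E_def field_simps)
  have b: "norm b \<le> 1 / 10" and E: "norm E \<le> \<bar>u\<bar> / 10"
    using T T' \<Delta> by (simp_all add: b_def E_def norm_divide)
  have N: "N > 0" using \<epsilon> by (simp add: N_def add_nonneg_pos)
  have "Q - of_real N = 2 * of_real u * E + E\<^sup>2"
    by (simp add: Q_def N_def power2_eq_square algebra_simps)
  then have "norm (Q - of_real N) \<le> 2 * \<bar>u\<bar> * norm E + (norm E)\<^sup>2"
    using norm_triangle_ineq[of "2 * of_real u * E" "E\<^sup>2"] by (simp add: norm_mult norm_power)
  also have "\<dots> \<le> 2 * \<bar>u\<bar> * (\<bar>u\<bar> / 10) + (\<bar>u\<bar> / 10)\<^sup>2"
    using E by (intro add_mono mult_left_mono power_mono) auto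
  also have "\<dots> = 21 / 100 * u\<^sup>2" by (simp add: power2_eq_square field_simps)
  also have "\<dots> \<le> N / 4" unfolding N_def by (simp add: field_simps)
  finally have QN: "norm (Q - of_real N) \<le> N / 4" .
  then have "Q \<noteq> 0" using N by auto
  define p q where "p = of_real u + E - \<i> * of_real \<epsilon>" and "q = of_real u + E + \<i> * of_real \<epsilon>"
  have pq: "\<Delta> - \<i> * of_real \<epsilon> * T = p * T" "\<Delta> + \<i> * of_real \<epsilon> * T = q * T"
    "q - p = \<i> * of_real (2 * \<epsilon>)" "Q = p * q"
    by (simp_all add: eqs(2) p_def q_def Q_def power2_eq_square algebra_simps)
  have nz: "p \<noteq> 0" "q \<noteq> 0" using \<open>Q \<noteq> 0\<close> pq(4) by auto
  have "T' * (1 / (\<Delta> - \<i> * of_real \<epsilon> * T) - 1 / (\<Delta> + \<i> * of_real \<epsilon> * T))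
      = (1 + b) * (q - p) / (p * q)"
    unfolding eqs(1) pq(1,2) using T0 nz by (simp add: field_simps)
  also have "\<dots> = \<i> * of_real (2 * \<epsilon>) * ((1 + b) / Q)"
    unfolding pq(3,4) by simp
  finally have "T' * (1 / (\<Delta> - \<i> * of_real \<epsilon> * T) - 1 / (\<Delta> + \<i> * of_real \<epsilon> * T))
      = \<i> * (of_real (2 * \<epsilon>) * ((1 + b) / Q))" by (simp only: mult.assoc)
  then have eq: "Im (T' * (1 / (\<Delta> - \<i> * of_real \<epsilon> * T) - 1 / (\<Delta> + \<i> * of_real \<epsilon> * T)))
      = 2 * \<epsilon> * Re ((1 + b) / Q)"
    by (simp only: Im_i_times times_complex.simps Re_complex_of_real Im_complex_of_real) simp
  have "2 * \<epsilon> * Re ((1 + b) / Q) \<ge> 2 * \<epsilon> * (1 / (2 * N))"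
    using Re_perturbed_quotient_ge[OF N b QN] \<epsilon> by (intro mult_left_mono) auto
  then show ?thesis using N unfolding eq N_def[symmetric] by simp
qed

section \<open>Jump of the winding number across the curve\<close>

context closed_curve
begin

abbreviation unit_param :: "real \<Rightarrow> complex" where
  "unit_param \<equiv> \<lambda>x. g (L * x)"

lemma unit_param_deriv: "(unit_param has_vector_derivative of_real L * D (Suc 0) (L * x)) (at x)"
proof -
  have "(g \<circ> (\<lambda>x. L * x) has_vector_derivative L *\<^sub>R D (Suc 0) (L * x)) (at x)"
    by (rule vector_diff_chain_at) (auto intro!: derivative_eq_intros g_deriv)
  then show ?thesis by (simp add: o_def scaleR_conv_of_real)
qed

lemma unit_param_valid: "valid_path unit_param"
  unfolding valid_path_def
proof (rule C1_differentiable_imp_piecewise)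
  show "unit_param C1_differentiable_on {0..1}"
    unfolding C1_differentiable_on_def
    by (intro exI[of _ "\<lambda>x. of_real L * D (Suc 0) (L * x)"] conjI ballI unit_param_deriv
        continuous_intros continuous_on_compose2[OF D_cont[of UNIV]]) auto
qed

lemma unit_param_simple: "simple_path unit_param"
  unfolding simple_path_def
proof
  show "path unit_param" using unit_param_valid by (rule valid_path_imp_path)
  show "loop_free unit_param"
    unfolding loop_free_def
  proof (intro ballI impI)
    fix x y :: real assume xy: "x \<in> {0..1}" "y \<in> {0..1}" "g (L * x) = g (L * y)"
    have "\<bar>L * y - L * x\<bar> = L * \<bar>y - x\<bar>"
      using L_pos by (simp add: abs_mult flip: right_diff_distrib)
    then have "\<not> (0 < \<bar>y - x\<bar> \<and> \<bar>y - x\<bar> < 1)"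
      using g_neq[of "L * y" "L * x"] xy(3) L_pos by auto
    then show "x = y \<or> x = 0 \<and> y = 1 \<or> x = 1 \<and> y = 0" using xy(1,2) by auto
  qed
qed

lemma unit_param_closed: "pathfinish unit_param = pathstart unit_param"
  using periodic[of 0] by (simp add: pathfinish_def pathstart_def)

lemma range_g: "g ` {0..L} = range g"
proof -
  have "g s \<in> g ` {0..L}" for s
  proof -
    obtain m where m: "s + of_int m * L \<in> {0..<L}" by (rule reduce_period)
    show ?thesis
      by (rule image_eqI[of _ _ "s + of_int m * L"]) (use m in \<open>auto simp: g_periodic_int\<close>)
  qed
  then show ?thesis by auto
qed

lemma unit_param_image: "path_image unit_param = range g"
proof -
  have "(\<lambda>x. L * x) ` {0..1} = {0..L}" using L_pos by simp
  then show ?thesis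
    unfolding range_g[symmetric] path_image_def by (metis image_image)
qed

text \<open>The base point \<open>L / 2\<close> puts the near-singularity at the centre of the
  parameter interval. Near it \<open>Im_jump_kernel_ge\<close> applies; away from it both the
  integrand and the Poisson kernel are O(\<epsilon>), absorbed by
  \<open>C * \<epsilon>\<close>.\<close>

lemma jump_kernel_lower_bound:
  defines "z \<equiv> \<lambda>\<epsilon>. tube g (L / 2, \<epsilon>)"
  obtains C \<epsilon>0 where "C > 0" "\<epsilon>0 > 0"
    "\<And>\<epsilon> u. \<lbrakk>0 < \<epsilon>; \<epsilon> \<le> \<epsilon>0; \<bar>u\<bar> \<le> L / 2\<rbrakk> \<Longrightarrow>
      \<epsilon> / (u\<^sup>2 + \<epsilon>\<^sup>2) - C * \<epsilon> \<le> Im (D (Suc 0) (L / 2 + u) *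
        (1 / (g (L / 2 + u) - z \<epsilon>) - 1 / (g (L / 2 + u) - z (- \<epsilon>))))"
proof -
  obtain K where K0: "K > 0" and K: "\<And>s. norm (D (Suc (Suc 0)) s) \<le> K"
    using D_bounded by blast
  \<comment> \<open>Makes the tangent rotation and the relative chord error at most 1/10, as
    \<open>Im_jump_kernel_ge\<close> requires.\<close>
  define d where "d = 1 / (10 * K)"
  have d: "d > 0" "K * d = 1 / 10" using K0 by (simp_all add: d_def)
  define S where "S = {-(L / 2)..L / 2} - {-d<..<d}"
  have "compact S" unfolding S_def by (intro compact_diff) auto
  then have "closed ((\<lambda>u. g (L / 2 + u) - g (L / 2)) ` S)"
    by (intro compact_imp_closed compact_continuous_image continuous_intros
        continuous_on_compose2[OF g_cont[of UNIV]]) auto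
  moreover have "0 \<notin> (\<lambda>u. g (L / 2 + u) - g (L / 2)) ` S"
  proof
    assume "0 \<in> (\<lambda>u. g (L / 2 + u) - g (L / 2)) ` S"
    then obtain u where u: "u \<in> S" "g (L / 2 + u) = g (L / 2)" by auto
    then show False using g_neq[of "L / 2 + u" "L / 2"] d L_pos by (auto simp: S_def)
  qed
  ultimately obtain m where m: "m > 0" "\<And>u. u \<in> S \<Longrightarrow> m \<le> norm (g (L / 2 + u) - g (L / 2))"
    using separate_point_closed[of "(\<lambda>u. g (L / 2 + u) - g (L / 2)) ` S" 0] by auto
  \<comment> \<open>For |u| at least \<open>d\<close> and \<epsilon> at most m/2, the first term
    bounds the integrand, whose two denominators are at least m/2 each; the second bounds \<epsilon>
    / (u^2 + \<epsilon>^2).\<close>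
  define C where "C = 8 / m\<^sup>2 + 1 / d\<^sup>2"
  have C: "C > 0" using m d by (simp add: C_def add_pos_pos)
  show thesis
  proof (rule that[OF C, of "m / 2"])
    fix \<epsilon> u assume \<epsilon>: "0 < \<epsilon>" "\<epsilon> \<le> m / 2" and u: "\<bar>u\<bar> \<le> L / 2"
    define T T' \<Delta> where "T = D (Suc 0) (L / 2)" and "T' = D (Suc 0) (L / 2 + u)"
      and "\<Delta> = g (L / 2 + u) - g (L / 2)"
    let ?k = "T' * (1 / (\<Delta> - \<i> * of_real \<epsilon> * T) - 1 / (\<Delta> + \<i> * of_real \<epsilon> * T))"
    have z: "g (L / 2 + u) - z \<epsilon> = \<Delta> - \<i> * of_real \<epsilon> * T"
      "g (L / 2 + u) - z (- \<epsilon>) = \<Delta> + \<i> * of_real \<epsilon> * T"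
      by (simp_all add: z_def tube_eq \<Delta>_def T_def)
    have "\<epsilon> / (u\<^sup>2 + \<epsilon>\<^sup>2) - C * \<epsilon> \<le> Im ?k"
    proof (cases "\<bar>u\<bar> < d")
      case True
      then have Ku: "K * \<bar>u\<bar> \<le> 1 / 10" using d(2) K0 mult_left_mono[of "\<bar>u\<bar>" d K] by linarith
      have "norm (T' - T) \<le> 1 / 10"
        using tangent_lipschitz[OF K, of "L / 2 + u" "L / 2"] Ku by (simp add: T_def T'_def)
      moreover have "norm (\<Delta> - of_real u * T) \<le> \<bar>u\<bar> / 10"
      proof -
        have "norm (\<Delta> - of_real u * T) \<le> K * u\<^sup>2"
          using chord_tangent[OF K, of "L / 2 + u" "L / 2"] by (simp add: T_def \<Delta>_def)
        also have "\<dots> = K * \<bar>u\<bar> * \<bar>u\<bar>" by (simp add: power2_eq_square)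
        also have "\<dots> \<le> 1 / 10 * \<bar>u\<bar>" using Ku by (intro mult_right_mono) auto
        finally show ?thesis by simp
      qed
      ultimately have "\<epsilon> / (u\<^sup>2 + \<epsilon>\<^sup>2) \<le> Im ?k"
        using \<epsilon>(1) by (intro Im_jump_kernel_ge) (auto simp: T_def unit)
      moreover have "C * \<epsilon> \<ge> 0" using C \<epsilon> by simp
      ultimately show ?thesis by linarith
    next
      case False
      then have "u \<in> S" using u by (auto simp: S_def)
      then have \<Delta>: "m \<le> norm \<Delta>" using m(2) by (simp add: \<Delta>_def)
      have iT: "norm (\<i> * of_real \<epsilon> * T) = \<epsilon>" using \<epsilon> by (simp add: T_def norm_mult unit)
      have lo: "m / 2 \<le> norm (\<Delta> - \<i> * of_real \<epsilon> * T)" "m / 2 \<le> norm (\<Delta> + \<i> * of_real \<epsilon> * T)"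
        using norm_triangle_ineq2[of \<Delta> "\<i> * of_real \<epsilon> * T"]
          norm_triangle_ineq2[of \<Delta> "- (\<i> * of_real \<epsilon> * T)"] \<Delta> iT \<epsilon>(2) by auto
      then have nz: "\<Delta> - \<i> * of_real \<epsilon> * T \<noteq> 0" "\<Delta> + \<i> * of_real \<epsilon> * T \<noteq> 0" using m(1) by auto
      have "?k = T' * (2 * (\<i> * of_real \<epsilon> * T))
          / ((\<Delta> - \<i> * of_real \<epsilon> * T) * (\<Delta> + \<i> * of_real \<epsilon> * T))"
        using nz by (simp add: field_simps)
      then have "norm ?k = 2 * \<epsilon> / (norm (\<Delta> - \<i> * of_real \<epsilon> * T) * norm (\<Delta> + \<i> * of_real \<epsilon> * T))"
        using iT by (simp add: norm_mult norm_divide T'_def unit)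
      also have "\<dots> \<le> 2 * \<epsilon> / (m / 2 * (m / 2))"
        using lo m(1) \<epsilon> by (intro divide_left_mono mult_mono mult_pos_pos) auto
      also have "\<dots> = 8 / m\<^sup>2 * \<epsilon>" by (simp add: power2_eq_square)
      finally have 1: "- Im ?k \<le> 8 / m\<^sup>2 * \<epsilon>"
        using abs_Im_le_cmod[of ?k] by linarith
      have "d\<^sup>2 \<le> u\<^sup>2" using False d(1) abs_le_square_iff[of d u] by simp
      then have "\<epsilon> / (u\<^sup>2 + \<epsilon>\<^sup>2) \<le> \<epsilon> / d\<^sup>2"
        using \<epsilon> d(1) by (intro divide_left_mono) (auto intro!: mult_pos_pos add_pos_nonneg add_increasing2)
      then show ?thesis using 1 by (simp add: C_def algebra_simps)
    qed
    then show "\<epsilon> / (u\<^sup>2 + \<epsilon>\<^sup>2) - C * \<epsilon> \<le> Im (D (Suc 0) (L / 2 + u) *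
        (1 / (g (L / 2 + u) - z \<epsilon>) - 1 / (g (L / 2 + u) - z (- \<epsilon>))))"
      by (simp only: z T'_def)
  qed (use m in auto)
qed

text \<open>The integrand of the difference is bounded below by a Poisson kernel up to a uniformly
  small error.\<close>

lemma winding_number_jump:
  obtains \<epsilon>1 where "\<epsilon>1 > 0"
    "\<And>\<epsilon>. \<lbrakk>0 < \<epsilon>; \<epsilon> \<le> \<epsilon>1; tube g (L / 2, \<epsilon>) \<notin> range g; tube g (L / 2, - \<epsilon>) \<notin> range g\<rbrakk> \<Longrightarrow>
      Re (winding_number unit_param (tube g (L / 2, - \<epsilon>)))
        < Re (winding_number unit_param (tube g (L / 2, \<epsilon>)))"
proof -
  obtain C \<epsilon>0 where C: "C > 0" "\<epsilon>0 > 0" and lower: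
    "\<And>\<epsilon> u. \<lbrakk>0 < \<epsilon>; \<epsilon> \<le> \<epsilon>0; \<bar>u\<bar> \<le> L / 2\<rbrakk> \<Longrightarrow>
      \<epsilon> / (u\<^sup>2 + \<epsilon>\<^sup>2) - C * \<epsilon> \<le> Im (D (Suc 0) (L / 2 + u) *
        (1 / (g (L / 2 + u) - tube g (L / 2, \<epsilon>)) - 1 / (g (L / 2 + u) - tube g (L / 2, - \<epsilon>))))"
    using jump_kernel_lower_bound by metis
  \<comment> \<open>The bound L/2 makes the arctangents contribute at least pi/2, the bound 1/(L C)
    keeps the accumulated error at most 1, and pi/2 > 1.\<close>
  define \<epsilon>1 where "\<epsilon>1 = min \<epsilon>0 (min (L / 2) (1 / (L * C)))"
  show thesis
  proof (rule that[of \<epsilon>1])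
    show "\<epsilon>1 > 0" using C L_pos by (simp add: \<epsilon>1_def)
    fix \<epsilon> assume \<epsilon>: "0 < \<epsilon>" "\<epsilon> \<le> \<epsilon>1"
      and z: "tube g (L / 2, \<epsilon>) \<notin> range g" "tube g (L / 2, - \<epsilon>) \<notin> range g"
    let ?z = "tube g (L / 2, \<epsilon>)" and ?z' = "tube g (L / 2, - \<epsilon>)"
    let ?w = "winding_number unit_param ?z" and ?w' = "winding_number unit_param ?z'"
    let ?h = "\<lambda>x. of_real L * (D (Suc 0) (L * x) * (1 / (g (L * x) - ?z) - 1 / (g (L * x) - ?z')))"
    have wn: "((\<lambda>x. 1 / (g (L * x) - y) * (of_real L * D (Suc 0) (L * x))) has_integral
        (2 * pi * \<i> * winding_number unit_param y)) {0..1}" if "y \<notin> range g" for y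
      using has_contour_integral_winding_number[OF unit_param_valid, of y] that
      by (simp add: unit_param_image has_contour_integral vector_derivative_at[OF unit_param_deriv])
    have "(?h has_integral (2 * pi * \<i> * ?w - 2 * pi * \<i> * ?w')) {0..1}"
      using has_integral_diff[OF wn[OF z(1)] wn[OF z(2)]] by (simp add: algebra_simps)
    \<comment> \<open>The winding numbers carry a factor 2 pi i, so the imaginary part of the
      integrand measures their real parts.\<close>
    from has_integral_linear[OF this bounded_linear_Im]
    have int: "((\<lambda>x. Im (?h x)) has_integral 2 * pi * (Re ?w - Re ?w')) {0..1}"
      unfolding o_def by (rule has_integral_eq_rhs) (simp add: right_diff_distrib)
    have Im_of_real_mult: "Im (of_real L * y) = L * Im y" for y by simp
    \<comment> \<open>Antiderivative of the lower bound: the Poisson kernel integrates to an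
      arctangent.\<close>
    let ?A = "\<lambda>x. arctan ((L * x - L / 2) / \<epsilon>) - L * C * \<epsilon> * x"
    have "((\<lambda>x. L * (\<epsilon> / ((L * x - L / 2)\<^sup>2 + \<epsilon>\<^sup>2) - C * \<epsilon>)) has_integral (?A 1 - ?A 0)) {0..1}"
    proof (rule fundamental_theorem_of_calculus)
      fix x :: real
      have "(1 + (y / \<epsilon>)\<^sup>2) * \<epsilon> = (y\<^sup>2 + \<epsilon>\<^sup>2) / \<epsilon>" for y
        using \<epsilon>(1) by (simp add: field_simps power2_eq_square)
      then have "L * (\<epsilon> / ((L * x - L / 2)\<^sup>2 + \<epsilon>\<^sup>2) - C * \<epsilon>)
          = inverse (1 + ((L * x - L / 2) / \<epsilon>)\<^sup>2) * (L / \<epsilon>) - L * C * \<epsilon>"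
        by (simp add: right_diff_distrib inverse_eq_divide)
      moreover have "(?A has_real_derivative
          inverse (1 + ((L * x - L / 2) / \<epsilon>)\<^sup>2) * (L / \<epsilon>) - L * C * \<epsilon>) (at x within {0..1})"
        using \<epsilon>(1) by (auto intro!: derivative_eq_intros)
      ultimately show "(?A has_vector_derivative
          L * (\<epsilon> / ((L * x - L / 2)\<^sup>2 + \<epsilon>\<^sup>2) - C * \<epsilon>)) (at x within {0..1})"
        by (simp only: has_real_derivative_iff_has_vector_derivative)
    qed simp
    from this int have "?A 1 - ?A 0 \<le> 2 * pi * (Re ?w - Re ?w')"
    proof (rule has_integral_le)
      show "L * (\<epsilon> / ((L * x - L / 2)\<^sup>2 + \<epsilon>\<^sup>2) - C * \<epsilon>) \<le> Im (?h x)" if "x \<in> {0..1}" for x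
      proof -
      have "\<bar>x - 1 / 2\<bar> \<le> 1 / 2" using that unfolding abs_le_iff by auto
      then have "L * \<bar>x - 1 / 2\<bar> \<le> L * (1 / 2)" using L_pos by (intro mult_left_mono) auto
      moreover have "L * x - L / 2 = L * (x - 1 / 2)" by (simp add: algebra_simps)
      then have "\<bar>L * x - L / 2\<bar> = L * \<bar>x - 1 / 2\<bar>"
        using L_pos by (simp only: abs_mult abs_of_pos)
      ultimately have "\<bar>L * x - L / 2\<bar> \<le> L / 2" by simp
      moreover have "L / 2 + (L * x - L / 2) = L * x" by simp
      moreover have "\<epsilon> \<le> \<epsilon>0" using \<epsilon>(2) by (simp add: \<epsilon>1_def)
      ultimately have "\<epsilon> / ((L * x - L / 2)\<^sup>2 + \<epsilon>\<^sup>2) - C * \<epsilon>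
          \<le> Im (D (Suc 0) (L * x) * (1 / (g (L * x) - ?z) - 1 / (g (L * x) - ?z')))"
        using lower[of \<epsilon> "L * x - L / 2"] \<epsilon>(1) by metis
      then show ?thesis
        unfolding Im_of_real_mult by (rule mult_left_mono) (use L_pos in simp)
      qed
    qed
    moreover have "?A 1 - ?A 0 > 0"
    proof -
      have "?A 1 - ?A 0 = 2 * arctan (L / 2 / \<epsilon>) - L * C * \<epsilon>"
        by (simp add: arctan_minus flip: minus_divide_left)
      moreover have "L / 2 / \<epsilon> \<ge> 1" using \<epsilon> by (simp add: \<epsilon>1_def field_simps)
      then have "arctan (L / 2 / \<epsilon>) \<ge> pi / 4"
        using arctan_monotone'[of 1 "L / 2 / \<epsilon>"] by simp
      moreover have "L * C * \<epsilon> \<le> L * C * (1 / (L * C))"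
        using \<epsilon> C L_pos by (intro mult_left_mono) (auto simp: \<epsilon>1_def)
      then have "L * C * \<epsilon> \<le> 1" using C L_pos by simp
      ultimately show ?thesis using pi_gt3 by linarith
    qed
    ultimately have "0 < 2 * pi * (Re ?w - Re ?w')" by linarith
    then show "Re ?w' < Re ?w" using pi_gt_zero by (simp add: zero_less_mult_iff)
  qed
qed

end

text \<open>If one point of the left strip missed \<open>\<Omega>\<close>, the whole strip would lie
  in the unbounded component, being connected and disjoint from the curve, and would have winding
  number 0. The winding number on the right is 0 or 1, but the jump makes it strictly smaller than
  on the left.\<close>

lemma (in tubular_curve) tube_positive_inside:
  assumes \<Omega>: "open \<Omega>" "bounded \<Omega>" "connected \<Omega>" "frontier \<Omega> = range g"
    and ccw: "\<And>z. z \<in> \<Omega> \<Longrightarrow> winding_number unit_param z = 1"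
    and t: "0 < t" "t < \<rho>"
  shows "tube g (s, t) \<in> \<Omega>"
proof (rule ccontr)
  assume notin: "tube g (s, t) \<notin> \<Omega>"
  let ?I = "inside (range g)" and ?O = "outside (range g)"
  have J: "open ?I" "connected ?I" "connected ?O" "\<not> bounded ?O" "?I \<union> ?O = - range g"
    using Jordan_inside_outside[OF unit_param_simple unit_param_closed]
    unfolding unit_param_image by auto
  have side: "S \<subseteq> \<Omega> \<or> S \<inter> \<Omega> = {}" if "connected S" "S \<inter> range g = {}" for S
    using connected_Int_frontier[OF that(1), of \<Omega>] that(2) \<Omega>(4) by blast
  have disj: "\<Omega> \<inter> range g = {}"
    using \<Omega>(1,4) frontier_disjoint_eq by blast
  \<comment> \<open>The outside is unbounded, so it cannot be contained in the bounded
    \<open>\<Omega>\<close>.\<close>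
  have "?O \<inter> \<Omega> = {}"
    using side[OF J(3)] J(4,5) \<Omega>(2) bounded_subset by blast
  then have "\<Omega> \<subseteq> ?I" using J(5) disj by blast
  moreover have "\<Omega> \<noteq> {}" using \<Omega>(4) by auto
  ultimately have I: "\<Omega> = ?I" using side[OF J(2)] J(5) by blast
  have off: "tube g (s', t') \<notin> range g" if "\<bar>t'\<bar> < \<rho>" "t' \<noteq> 0" for s' t'
  proof
    assume "tube g (s', t') \<in> range g"
    then obtain u where "tube g (s', t') = tube g (u, 0)" by (auto simp: tube_eq)
    then show False using tube_eqD(1)[of s' t' u 0] that \<rho>_pos by simp
  qed
  let ?A = "tube g ` (UNIV \<times> {0<..<\<rho>})"
  have "connected ?A"
  proof (rule connected_continuous_image)
    show "continuous_on (UNIV \<times> {0<..<\<rho>}) (tube g)"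
      using tube_deriv by (intro continuous_at_imp_continuous_on) (auto intro: has_derivative_continuous)
    show "connected ((UNIV :: real set) \<times> {0<..<\<rho>})"
      by (intro connected_Times) auto
  qed
  moreover have "?A \<inter> range g = {}"
  proof -
    have "tube g (s', t') \<notin> range g" if "t' \<in> {0<..<\<rho>}" for s' t'
      using off[of t' s'] that by simp
    then show ?thesis by blast
  qed
  ultimately have A: "?A \<inter> \<Omega> = {}" using side[of ?A] notin t by force
  obtain \<epsilon>1 where "\<epsilon>1 > 0" and jump:
    "\<And>\<epsilon>. \<lbrakk>0 < \<epsilon>; \<epsilon> \<le> \<epsilon>1; tube g (L / 2, \<epsilon>) \<notin> range g; tube g (L / 2, - \<epsilon>) \<notin> range g\<rbrakk> \<Longrightarrow>
      Re (winding_number unit_param (tube g (L / 2, - \<epsilon>)))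
        < Re (winding_number unit_param (tube g (L / 2, \<epsilon>)))"
    using winding_number_jump by blast
  define \<epsilon> where "\<epsilon> = min \<epsilon>1 (\<rho> / 2)"
  have \<epsilon>: "0 < \<epsilon>" "\<epsilon> \<le> \<epsilon>1" "\<epsilon> < \<rho>" using \<open>\<epsilon>1 > 0\<close> \<rho>_pos by (auto simp: \<epsilon>_def)
  have out: "winding_number unit_param z = 0" if "z \<in> ?O" for z
    using winding_number_zero_in_outside[OF simple_path_imp_path[OF unit_param_simple] unit_param_closed]
      that by (simp add: unit_param_image)
  let ?z = "tube g (L / 2, \<epsilon>)" and ?z' = "tube g (L / 2, - \<epsilon>)"
  have z: "?z \<notin> range g" "?z' \<notin> range g" using off \<epsilon> by auto
  have "?z \<in> ?A" using \<epsilon> by (intro imageI) auto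
  then have "?z \<in> ?O" using A z(1) I J(5) by blast
  \<comment> \<open>The right-hand point may lie on either side: both possible values are
    nonnegative, which is all the contradiction needs.\<close>
  moreover have "?z' \<in> \<Omega> \<or> ?z' \<in> ?O" using z(2) I J(5) by blast
  then have "0 \<le> Re (winding_number unit_param ?z')" using ccw out by auto
  ultimately show False using jump[OF \<epsilon>(1,2) z] out by simp
qed

section \<open>Smoothness in tube coordinates\<close>

text \<open>The term T' times \<open>cnj T'\<close> of the product rule is real, so under Im only
  the term with the third derivative of the curve survives.\<close>

lemma (in closed_curve) curvature_deriv:
  "((\<lambda>w. curvature (Re w)) has_derivative
     (\<lambda>h. Re h * Im (D (Suc (Suc (Suc 0))) (Re w) * cnj (D (Suc 0) (Re w))))) (at w)"
proof -
  have "((\<lambda>w. Im (D (Suc (Suc 0)) (Re w) * cnj (D (Suc 0) (Re w)))) has_derivative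
      (\<lambda>h. Im (D (Suc (Suc 0)) (Re w) * cnj (Re h *\<^sub>R D (Suc (Suc 0)) (Re w))
        + Re h *\<^sub>R D (Suc (Suc (Suc 0))) (Re w) * cnj (D (Suc 0) (Re w))))) (at w)"
    by (intro bounded_linear.has_derivative[OF bounded_linear_Im] has_derivative_mult
        bounded_linear.has_derivative[OF bounded_linear_cnj] D_Re_deriv)
  then show ?thesis
    unfolding curvature_def by (rule has_derivative_eq_rhs) (simp add: fun_eq_iff algebra_simps)
qed

context tubular_curve
begin

lemma tubec_eqD:
  assumes "tubec w = tubec w'" "\<bar>Im w\<bar> < \<rho>" "\<bar>Im w'\<bar> < \<rho>"
  shows "Im w = Im w'" "\<exists>m :: int. Re w' = Re w + of_int m * L"
  using tube_eqD[of "Re w" "Im w" "Re w'" "Im w'"] assms by (auto simp: tubec_def)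

text \<open>Two parameters in an open window of width L cannot differ by a nonzero period. This
  yields local inverses of the periodic tube map.\<close>

lemma tubec_inj_on:
  "inj_on tubec {w. \<bar>Im w\<bar> < \<rho> \<and> \<bar>Re w - s\<bar> < L / 2}"
proof (rule inj_onI)
  fix w w'
  assume "w \<in> {w. \<bar>Im w\<bar> < \<rho> \<and> \<bar>Re w - s\<bar> < L / 2}"
    "w' \<in> {w. \<bar>Im w\<bar> < \<rho> \<and> \<bar>Re w - s\<bar> < L / 2}" "tubec w = tubec w'"
  then have *: "tubec w = tubec w'" "\<bar>Im w\<bar> < \<rho>" "\<bar>Im w'\<bar> < \<rho>"
    "\<bar>Re w - s\<bar> < L / 2" "\<bar>Re w' - s\<bar> < L / 2"
    by simp_all
  have "\<bar>Re w' - Re w\<bar> < L" using *(4,5) by linarith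
  moreover have "g (Re w) = g (Re w')"
    using tubec_eqD(2)[OF *(1,2,3)] g_periodic_int by metis
  ultimately have "Re w = Re w'" using g_neq[of "Re w'" "Re w"] by fastforce
  then show "w = w'" using tubec_eqD(1)[OF *(1,2,3)] by (simp add: complex_eq_iff)
qed

end

section \<open>Descent of smooth functions along the tube map\<close>

locale shifted_tube = tubular_curve +
  fixes U :: "complex set" and r :: real and I :: "'i set"
    and E :: "'i \<Rightarrow> bool list \<Rightarrow> complex \<Rightarrow> real"
  assumes U_open: "open U"
    and E_deriv: "\<And>i ds. i \<in> I \<Longrightarrow> has_partials_on U (E i ds) (E i (False # ds)) (E i (True # ds))"
begin

text \<open>The tube map is inverted at \<open>w\<close>, hence the bound by \<open>\<rho>\<close>
  there; at the shifted point it is only composed with a coefficient, so landing in \<open>U\<close>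
  suffices.\<close>

definition shift_domain :: "complex set" where
  "shift_domain = {w. \<bar>Im w\<bar> < \<rho> \<and> tubec (w + \<i> * of_real r) \<in> U}"

text \<open>The algebra generated by these functions of the tube coordinates $w = s + it$ is closed under both
  partial derivatives, even after pulling back along the inverse of the tube map. Hence all its
  elements are smooth without any general smoothness theory for compositions and inverses.\<close>

definition gens :: "(complex \<Rightarrow> real) set" where
  "gens = range (\<lambda>k w. Re (D k (Re w))) \<union> range (\<lambda>k w. Im (D k (Re w)))
     \<union> {Im, \<lambda>w. inverse (1 - Im w * curvature (Re w))}
     \<union> (\<lambda>(i, ds) w. E i ds (tubec (w + \<i> * of_real r))) ` (I \<times> UNIV)"

lemma shift_domain_open: "open shift_domain"
proof -
  have "open ((\<lambda>w. tubec (w + \<i> * of_real r)) -` U)"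
    by (intro continuous_open_vimage U_open continuous_intros
        continuous_on_compose2[OF tubec_cont[of UNIV]]) auto
  moreover have "open {w :: complex. \<bar>Im w\<bar> < \<rho>}"
    by (intro open_Collect_less continuous_intros)
  moreover have "shift_domain = {w. \<bar>Im w\<bar> < \<rho>} \<inter> (\<lambda>w. tubec (w + \<i> * of_real r)) -` U"
    by (auto simp: shift_domain_def)
  ultimately show ?thesis by auto
qed

lemma gens_mem:
  "(\<lambda>w. Re (D k (Re w))) \<in> fun_alg gens"
  "(\<lambda>w. Im (D k (Re w))) \<in> fun_alg gens"
  "Im \<in> fun_alg gens"
  "(\<lambda>w. inverse (1 - Im w * curvature (Re w))) \<in> fun_alg gens"
  "i \<in> I \<Longrightarrow> (\<lambda>w. E i ds (tubec (w + \<i> * of_real r))) \<in> fun_alg gens"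
  by (auto simp: gens_def intro!: fun_alg.gen)

lemma Im_D_cnj_D_mem: "(\<lambda>w. Im (D k (Re w) * cnj (D l (Re w)))) \<in> fun_alg gens"
proof -
  have "(\<lambda>w. Im (D k (Re w)) * Re (D l (Re w)) - Re (D k (Re w)) * Im (D l (Re w))) \<in> fun_alg gens"
    by (intro fun_alg_intros gens_mem)
  then show ?thesis by (simp add: algebra_simps)
qed

lemma curvature_mem: "(\<lambda>w. curvature (Re w)) \<in> fun_alg gens"
  unfolding curvature_def by (rule Im_D_cnj_D_mem)

text \<open>Three mechanisms keep the partials in the algebra: \<open>D k\<close> passes to
  \<open>D (Suc k)\<close>; the reciprocal m of 1 - t curvature satisfies dm = m^2 d(t curvature);
  and \<open>E i ds\<close> passes by the chain rule to \<open>E i (b # ds)\<close> with factors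
  from the differential of the tube map.\<close>

lemma gens_partials:
  assumes "f \<in> gens"
  shows "\<exists>p\<in>fun_alg gens. \<exists>q\<in>fun_alg gens. has_partials_on shift_domain f p q"
proof -
  have zero: "(\<lambda>_. 0) \<in> fun_alg gens" and one: "(\<lambda>_. 1) \<in> fun_alg gens"
    by (rule fun_alg.const)+
  consider k where "f = (\<lambda>w. Re (D k (Re w)))" | k where "f = (\<lambda>w. Im (D k (Re w)))" | "f = Im"
    | "f = (\<lambda>w. inverse (1 - Im w * curvature (Re w)))"
    | i ds where "i \<in> I" "f = (\<lambda>w. E i ds (tubec (w + \<i> * of_real r)))"
    using assms by (auto simp: gens_def)
  then show ?thesis
  proof cases
    case 1
    have "has_partials_on shift_domain f (\<lambda>w. Re (D (Suc k) (Re w))) (\<lambda>_. 0)"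
      unfolding has_partials_on_def 1
      by (auto intro!: has_derivative_eq_rhs[OF bounded_linear.has_derivative[OF bounded_linear_Re D_Re_deriv]])
    then show ?thesis using gens_mem(1) zero by blast
  next
    case 2
    have "has_partials_on shift_domain f (\<lambda>w. Im (D (Suc k) (Re w))) (\<lambda>_. 0)"
      unfolding has_partials_on_def 2
      by (auto intro!: has_derivative_eq_rhs[OF bounded_linear.has_derivative[OF bounded_linear_Im D_Re_deriv]])
    then show ?thesis using gens_mem(2) zero by blast
  next
    case 3
    have "has_partials_on shift_domain f (\<lambda>_. 0) (\<lambda>_. 1)"
      unfolding has_partials_on_def 3
      by (auto intro!: has_derivative_eq_rhs[OF bounded_linear_imp_has_derivative[OF bounded_linear_Im]])
    then show ?thesis using one zero by blast
  next
    case 4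
    let ?m = "\<lambda>w. inverse (1 - Im w * curvature (Re w))"
      and ?k' = "\<lambda>w. Im (D (Suc (Suc (Suc 0))) (Re w) * cnj (D (Suc 0) (Re w)))"
    let ?p = "\<lambda>w. ?m w * ?m w * (Im w * ?k' w)" and ?q = "\<lambda>w. ?m w * ?m w * curvature (Re w)"
    have "has_partials_on shift_domain f ?p ?q"
      unfolding has_partials_on_def 4
    proof
      fix w assume "w \<in> shift_domain"
      then have nz: "1 - Im w * curvature (Re w) \<noteq> 0" using curvature_radius by (simp add: shift_domain_def)
      have "((\<lambda>w. 1 - Im w * curvature (Re w)) has_derivative
          (\<lambda>h. 0 - (Im w * (Re h * ?k' w) + Im h * curvature (Re w)))) (at w)"
        by (intro has_derivative_diff has_derivative_const has_derivative_mult curvature_deriv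
            bounded_linear_imp_has_derivative bounded_linear_Im)
      from Deriv.has_derivative_inverse[OF nz this]
      show "(?m has_derivative (\<lambda>h. Re h * ?p w + Im h * ?q w)) (at w)"
        by (rule has_derivative_eq_rhs) (simp add: fun_eq_iff algebra_simps del: times_complex.simps)
    qed
    moreover have "?p \<in> fun_alg gens" "?q \<in> fun_alg gens"
      by (intro fun_alg.mult gens_mem Im_D_cnj_D_mem curvature_mem)+
    ultimately show ?thesis by blast
  next
    case 5
    let ?z = "\<lambda>w. tubec (w + \<i> * of_real r)"
      and ?c = "\<lambda>w. Re (D (Suc 0) (Re w))" and ?d = "\<lambda>w. Im (D (Suc 0) (Re w))"
      \<comment> \<open>The tangential stretch at the shifted height Im w + r; it enters as a factor
        only and is never inverted.\<close>
      and ?l = "\<lambda>w. 1 - (Im w + r) * curvature (Re w)"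
    let ?p = "\<lambda>w. ?l w * (?c w * E i (False # ds) (?z w) + ?d w * E i (True # ds) (?z w))"
      and ?q = "\<lambda>w. ?c w * E i (True # ds) (?z w) - ?d w * E i (False # ds) (?z w)"
    have "has_partials_on shift_domain f ?p ?q"
      unfolding has_partials_on_def 5
    proof
      fix w assume "w \<in> shift_domain"
      then have "?z w \<in> U" by (simp add: shift_domain_def)
      then have 1: "(E i ds has_derivative
          (\<lambda>h. Re h * E i (False # ds) (?z w) + Im h * E i (True # ds) (?z w))) (at (?z w))"
        using E_deriv[OF 5(1)] by (simp add: has_partials_on_def)
      have "((\<lambda>w. w + \<i> * of_real r) has_derivative (\<lambda>h. h)) (at w)"
        by (auto intro!: derivative_eq_intros)
      from diff_chain_at[OF this tubec_deriv]
      have "(?z has_derivative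
          (\<lambda>h. D (Suc 0) (Re w) * Complex (Re h * ?l w) (Im h))) (at w)"
        by (simp add: o_def)
      from diff_chain_at[OF this 1] show "((\<lambda>w. E i ds (?z w)) has_derivative (\<lambda>h. Re h * ?p w + Im h * ?q w)) (at w)"
        unfolding o_def by (rule has_derivative_eq_rhs) (simp add: fun_eq_iff algebra_simps)
    qed
    moreover have "?p \<in> fun_alg gens" "?q \<in> fun_alg gens"
      by (intro fun_alg_intros gens_mem 5(1) curvature_mem)+
    ultimately show ?thesis by blast
  qed
qed

text \<open>Preimages of one point differ by a multiple of the period in s, under which every
  generator is invariant. So composing with an arbitrary choice of preimage is unambiguous.\<close>

lemma fun_alg_gens_descend:
  assumes "f \<in> fun_alg gens" "w \<in> shift_domain" "w' \<in> shift_domain" "tubec w = tubec w'"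
  shows "f w = f w'"
proof -
  obtain m :: int where m: "Re w' = Re w + of_int m * L" and Im: "Im w = Im w'"
    using tubec_eqD[OF assms(4)] assms(2,3) by (auto simp: shift_domain_def)
  have per: "D k (Re w') = D k (Re w)" "curvature (Re w') = curvature (Re w)" for k
    by (simp_all add: m D_periodic_int curvature_def)
  have "tubec (w' + \<i> * of_real r) = tubec (w + \<i> * of_real r)"
    by (simp add: tubec_def m Im tube_periodic_int)
  with assms(1) show ?thesis
    by induction (auto simp: gens_def per Im)
qed

text \<open>Injectivity holds only on windows shorter than a period, so invariance of domain is
  applied window by window.\<close>

lemma tubec_image_open: "open (tubec ` shift_domain)"
proof -
  have "open (tubec ` (shift_domain \<inter> {w. \<bar>Re w - s\<bar> < L / 2}))" for s
  proof (rule invariance_of_domain[OF tubec_cont])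
    show "open (shift_domain \<inter> {w. \<bar>Re w - s\<bar> < L / 2})"
      by (intro open_Int shift_domain_open open_Collect_less continuous_intros)
    show "inj_on tubec (shift_domain \<inter> {w. \<bar>Re w - s\<bar> < L / 2})"
      by (rule inj_on_subset[OF tubec_inj_on[of s]]) (auto simp: shift_domain_def)
  qed
  moreover have "tubec ` shift_domain = (\<Union>s. tubec ` (shift_domain \<inter> {w. \<bar>Re w - s\<bar> < L / 2}))"
  proof -
    have "w \<in> shift_domain \<inter> {w'. \<bar>Re w' - Re w\<bar> < L / 2}" if "w \<in> shift_domain" for w using that L_pos by simp
    then show ?thesis by blast
  qed
  ultimately show ?thesis by auto
qed

text \<open>The chosen preimage \<open>h\<close> may jump at a seam. On a window \<open>B\<close>
  around the chosen point the tube map has a differentiable inverse, and by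
  \<open>fun_alg_gens_descend\<close> f takes the same values through either inverse.\<close>

lemma descended_partials:
  fixes h defines "h \<equiv> inv_into shift_domain tubec"
  assumes f: "f \<in> fun_alg gens" "has_partials_on shift_domain f p q"
  shows "has_partials_on (tubec ` shift_domain) (f \<circ> h)
    ((\<lambda>w. p w * (inverse (1 - Im w * curvature (Re w)) * Re (D (Suc 0) (Re w)))
        - q w * Im (D (Suc 0) (Re w))) \<circ> h)
    ((\<lambda>w. p w * (inverse (1 - Im w * curvature (Re w)) * Im (D (Suc 0) (Re w)))
        + q w * Re (D (Suc 0) (Re w))) \<circ> h)"
  unfolding has_partials_on_def
proof
  fix z assume z: "z \<in> tubec ` shift_domain"
  define w where "w = h z"
  have w: "w \<in> shift_domain" "tubec w = z"
    using z by (auto simp: w_def h_def inv_into_into f_inv_into_f)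
  define B where "B = shift_domain \<inter> {w'. \<bar>Re w' - Re w\<bar> < L / 2}"
  have "open B"
    unfolding B_def by (intro open_Int shift_domain_open open_Collect_less continuous_intros)
  moreover have "w \<in> B" "B \<subseteq> shift_domain" using w L_pos by (auto simp: B_def)
  ultimately have B: "open B" "w \<in> B" "B \<subseteq> shift_domain" by blast+
  have inj_B: "inj_on tubec B"
    by (rule inj_on_subset[OF tubec_inj_on[of "Re w"]]) (auto simp: B_def shift_domain_def)
  have open_B: "open (tubec ` B)"
    by (rule invariance_of_domain[OF tubec_cont B(1) inj_B])
  let ?T = "D (Suc 0) (Re w)"
  define l where "l = 1 - Im w * curvature (Re w)"
  have l: "l \<noteq> 0" using curvature_radius w(1) by (simp add: l_def shift_domain_def)
  \<comment> \<open>Inverse of the differential: rotate back by \<open>cnj ?T\<close>, then divide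
    the tangential component by \<open>l\<close>.\<close>
  let ?\<phi> = "inv_into B tubec" and ?\<phi>' = "\<lambda>k. Complex (Re (k * cnj ?T) * inverse l) (Im (k * cnj ?T))"
  have "(?\<phi> has_derivative ?\<phi>') (at (tubec w))"
  proof (rule has_derivative_inverse_strong[OF B(1,2) tubec_cont _ tubec_deriv])
    show "?\<phi> (tubec x) = x" if "x \<in> B" for x using inj_B that by simp
    have "?T * (k * cnj ?T) = k" for k
      using unit_cnj[of "Re w"] by (simp add: mult.left_commute[of _ k])
    moreover have "Complex (Re y * inverse l * l) (Im y) = y" for y
      using l by (simp add: complex_eq_iff)
    ultimately show "(\<lambda>h. ?T * Complex (Re h * (1 - Im w * curvature (Re w))) (Im h)) \<circ> ?\<phi>' = id"
      unfolding l_def[symmetric] by (simp add: fun_eq_iff del: times_complex.simps)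
  qed
  then have "(?\<phi> has_derivative ?\<phi>') (at z)" by (simp only: w(2))
  moreover have "?\<phi> z = w" using inj_B B(2) w(2) by force
  moreover have "(f has_derivative (\<lambda>k. Re k * p w + Im k * q w)) (at w)"
    using f(2) w(1) by (simp add: has_partials_on_def)
  ultimately have "(f \<circ> ?\<phi> has_derivative (\<lambda>k. Re k * p w + Im k * q w) \<circ> ?\<phi>') (at z)"
    by (intro diff_chain_at) simp_all
  then have "(f \<circ> h has_derivative (\<lambda>k. Re k * p w + Im k * q w) \<circ> ?\<phi>') (at z)"
  proof (rule has_derivative_transform_within_open[OF _ open_B])
    show "z \<in> tubec ` B" using B(2) w(2) by blast
    show "(f \<circ> ?\<phi>) y = (f \<circ> h) y" if "y \<in> tubec ` B" for y
    proof -
      have "y \<in> tubec ` shift_domain" using that B(3) by blast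
      then show ?thesis
        using that B(3) inv_into_into[OF that] unfolding o_def h_def
        by (intro fun_alg_gens_descend[OF f(1)]) (auto simp: inv_into_into f_inv_into_f)
    qed
  qed
  then show "(f \<circ> h has_derivative (\<lambda>k.
      Re k * ((\<lambda>w. p w * (inverse (1 - Im w * curvature (Re w)) * Re (D (Suc 0) (Re w)))
        - q w * Im (D (Suc 0) (Re w))) \<circ> h) z +
      Im k * ((\<lambda>w. p w * (inverse (1 - Im w * curvature (Re w)) * Im (D (Suc 0) (Re w)))
        + q w * Re (D (Suc 0) (Re w))) \<circ> h) z)) (at z)"
    by (rule has_derivative_eq_rhs)
       (simp add: fun_eq_iff algebra_simps l_def flip: w_def)
qed

text \<open>The inverse differential brings in 1/(1 - t curvature); having this reciprocal among the
  generators is what keeps the descended family closed under partials.\<close>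

lemma smooth_descended:
  assumes "f \<in> fun_alg gens"
  shows "smooth_on_open (tubec ` shift_domain) (f \<circ> inv_into shift_domain tubec)"
proof (rule smooth_on_openI[OF tubec_image_open])
  let ?\<F> = "(\<lambda>f. f \<circ> inv_into shift_domain tubec) ` fun_alg gens"
  show "f \<circ> inv_into shift_domain tubec \<in> ?\<F>" using assms by blast
  fix h assume "h \<in> ?\<F>"
  then obtain f where f: "f \<in> fun_alg gens" "h = f \<circ> inv_into shift_domain tubec" by blast
  obtain p q where pq: "p \<in> fun_alg gens" "q \<in> fun_alg gens" "has_partials_on shift_domain f p q"
    using fun_alg_partials[OF f(1) gens_partials] by blast
  let ?m = "\<lambda>w. inverse (1 - Im w * curvature (Re w))"
  have "(\<lambda>w. p w * (?m w * Re (D (Suc 0) (Re w))) - q w * Im (D (Suc 0) (Re w))) \<in> fun_alg gens"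
    "(\<lambda>w. p w * (?m w * Im (D (Suc 0) (Re w))) + q w * Re (D (Suc 0) (Re w))) \<in> fun_alg gens"
    by (intro fun_alg_diff fun_alg.add fun_alg.mult pq gens_mem)+
  with descended_partials[OF f(1) pq(3)]
  show "\<exists>p\<in>?\<F>. \<exists>q\<in>?\<F>. has_partials_on (tubec ` shift_domain) h p q"
    unfolding f(2) by blast
qed

lemma smooth_upto_descend:
  assumes f: "f \<in> fun_alg gens" and S: "S \<subseteq> tubec ` A" "A \<subseteq> shift_domain"
    and F: "\<And>w. w \<in> A \<Longrightarrow> F (tubec w) = f w"
  shows "smooth_upto S F"
  unfolding smooth_upto_def
proof (intro exI conjI ballI)
  show "S \<subseteq> tubec ` shift_domain" using S by blast
  show "smooth_on_open (tubec ` shift_domain) (f \<circ> inv_into shift_domain tubec)" by (rule smooth_descended[OF f])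
  fix x assume "x \<in> S"
  then obtain w where w: "w \<in> A" "x = tubec w" using S by blast
  then have "x \<in> tubec ` shift_domain" using S by blast
  then have "f (inv_into shift_domain tubec x) = f w"
    using w S by (intro fun_alg_gens_descend[OF f]) (auto simp: inv_into_into f_inv_into_f)
  then show "(f \<circ> inv_into shift_domain tubec) x = F x" using F w by simp
qed

end

section \<open>Smoothness of the integral on the annulus of centres\<close>

lemma (in tubular_curve) Omega_r_compact: "compact (Omega_r g r)"
proof -
  have "Omega_r g r = tube g ` ({0..L} \<times> {-r..r})"
  proof
    show "Omega_r g r \<subseteq> tube g ` ({0..L} \<times> {-r..r})"
      unfolding Omega_r_def
    proof clarify
      fix s t assume t: "t \<in> {-r..r}"
      obtain m where m: "s + of_int m * L \<in> {0..<L}" by (rule reduce_period)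
      show "tube g (s, t) \<in> tube g ` ({0..L} \<times> {-r..r})"
        by (rule image_eqI[of _ _ "(s + of_int m * L, t)"]) (use m t in \<open>auto simp: tube_periodic_int\<close>)
    qed
  qed (auto simp: Omega_r_def)
  moreover have "continuous_on ({0..L} \<times> {-r..r}) (tube g)"
    using tube_deriv by (intro continuous_at_imp_continuous_on) (auto intro: has_derivative_continuous)
  ultimately show ?thesis by (simp add: compact_continuous_image compact_Times)
qed

theorem theorem2p3:
  fixes \<gamma> :: "real \<Rightarrow> complex" and L \<beta> r :: real and \<Omega> :: "complex set"
    and \<Phi> :: "complex \<Rightarrow> complex \<Rightarrow> real" and F :: "complex \<Rightarrow> real"
  assumes curve: "arclength_simple_closed \<gamma> L"
    and domain: "open \<Omega>" "bounded \<Omega>" "connected \<Omega>" "frontier \<Omega> = \<gamma> ` {0..L}"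
    and ccw: "\<forall>z\<in>\<Omega>. winding_number (\<lambda>t. \<gamma> (L * t)) z = 1"
    and beta: "\<beta> > 0" "r = 1 / \<beta>"
    and curvature: "r < tube_radius \<gamma> L / 2"
    and integral: "poly_momenta_integral \<gamma> L \<Omega> r \<Phi>"
    and F_def: "\<forall>x\<in>closure \<Omega>. \<forall>v. norm v = 1 \<and>
                  sphere (x + of_real r * \<i> * v) r \<inter> \<gamma> ` {0..L} \<noteq> {} \<longrightarrow>
                  F (x + of_real r * \<i> * v) = \<Phi> x v"
  shows "smooth_upto (closure (Omega_r \<gamma> r)) F"
proof -
  have r: "r > 0" using beta by simp
  obtain D where D: "D 0 = \<gamma>" "\<And>k t. (D k has_vector_derivative D (Suc k) t) (at t)"
    using curve unfolding arclength_simple_closed_def smooth_curve_def by blast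
  have "vector_derivative \<gamma> (at s) = D (Suc 0) s" for s
    using D by (metis vector_derivative_at)
  then interpret closed_curve \<gamma> L D
    using curve D by unfold_locales (auto simp: arclength_simple_closed_def)
  \<comment> \<open>The strict inequality with the supremum leaves an admissible radius beyond 2 r,
    so all heights in [0, 2 r] are interior to the tube.\<close>
  obtain \<rho> where \<rho>: "\<rho> > 2 * r" "tube_diffeo \<gamma> L \<rho>"
    using tube_radius_gt[of "2 * r"] curvature by auto
  interpret tubular_curve \<gamma> L D \<rho>
    using \<rho> r by unfold_locales auto
  from integral[unfolded poly_momenta_integral_def, THEN conjunct1] obtain N a where
    Na: "(\<forall>k l. smooth_upto (Omega_plus \<gamma> r) (a k l)) \<and>
      (\<forall>x\<in>Omega_plus \<gamma> r. \<forall>v. norm v = 1 \<longrightarrow>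
        \<Phi> x v = (\<Sum>k\<le>N. \<Sum>l\<le>N - k. a k l x * Re v ^ k * Im v ^ l))"
    by (elim exE)
  then have smooth: "smooth_upto (Omega_plus \<gamma> r) (a k l)" for k l by simp
  have \<Phi>: "\<Phi> x v = (\<Sum>k\<le>N. \<Sum>l\<le>N - k. a k l x * Re v ^ k * Im v ^ l)"
    if "x \<in> Omega_plus \<gamma> r" "norm v = 1" for x v
    using Na that by simp
  \<comment> \<open>Unpacks each coefficient into a tree of partials on an open set, in a shape that
    allows choice over all index pairs.\<close>
  have "\<exists>V E. Omega_plus \<gamma> r \<subseteq> V \<and> open V \<and> (\<forall>x\<in>Omega_plus \<gamma> r. E [] x = a (fst i) (snd i) x) \<and>
      (\<forall>ds. has_partials_on V (E ds) (E (False # ds)) (E (True # ds)))" for i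
  proof -
    obtain V h where V: "Omega_plus \<gamma> r \<subseteq> V" "smooth_on_open V h"
      "\<forall>x\<in>Omega_plus \<gamma> r. h x = a (fst i) (snd i) x"
      using smooth unfolding smooth_upto_def by blast
    then obtain E where "open V" "\<forall>x\<in>V. E [] x = h x"
      "\<forall>ds. has_partials_on V (E ds) (E (False # ds)) (E (True # ds))"
      unfolding smooth_on_open_def has_partials_on_def by blast
    with V show ?thesis by (intro exI[of _ V] exI[of _ E]) auto
  qed
  then obtain V E where V: "\<And>i. Omega_plus \<gamma> r \<subseteq> V i" "\<And>i. open (V i)"
    and E: "\<And>i x. x \<in> Omega_plus \<gamma> r \<Longrightarrow> E i [] x = a (fst i) (snd i) x"
    and E_deriv: "\<And>i ds. has_partials_on (V i) (E i ds) (E i (False # ds)) (E i (True # ds))"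
    by metis
  \<comment> \<open>The square contains all exponent pairs with k + l at most N and is finite, so
    the intersection \<open>U\<close> is still open.\<close>
  define I where "I = {..N} \<times> {..N}"
  define U where "U = (\<Inter>i\<in>I. V i)"
  have U: "open U" "Omega_plus \<gamma> r \<subseteq> U"
    using V by (auto simp: U_def I_def)
  have EU: "has_partials_on U (E i ds) (E i (False # ds)) (E i (True # ds))" if "i \<in> I" for i ds
    using E_deriv[of i ds] that by (auto simp: has_partials_on_def U_def)
  let ?x = "\<lambda>w. tubec (w + \<i> * of_real r)" and ?v = "\<lambda>w. - D (Suc 0) (Re w)"
  \<comment> \<open>The polynomial with its coefficients replaced by their smooth extensions, hence
    visibly built from generators.\<close>
  let ?f = "\<lambda>w. \<Sum>k\<le>N. \<Sum>l\<le>N - k. E (k, l) [] (?x w) * (- Re (D (Suc 0) (Re w))) ^ k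
      * (- Im (D (Suc 0) (Re w))) ^ l"
  let ?A = "{w. \<bar>Im w\<bar> \<le> r}"
  have x_mem: "?x w \<in> Omega_plus \<gamma> r" if "w \<in> ?A" for w
    unfolding Omega_plus_def tubec_def using that by (intro imageI) auto
  interpret shifted_tube \<gamma> L D \<rho> U r I E
    using U(1) EU by unfold_locales
  show ?thesis
  proof (rule smooth_upto_descend[of ?f _ ?A])
    show "?f \<in> fun_alg gens"
      by (intro fun_alg_sum fun_alg.mult fun_alg_power fun_alg_uminus gens_mem) (auto simp: I_def)
    show "?A \<subseteq> shift_domain"
      using x_mem U(2) \<rho>(1) r by (auto simp: shift_domain_def)
    have "closure (Omega_r \<gamma> r) = Omega_r \<gamma> r"
      by (simp add: closure_closed compact_imp_closed Omega_r_compact)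
    also have "\<dots> \<subseteq> tubec ` ?A"
      unfolding Omega_r_def
    proof clarify
      fix s t assume "t \<in> {-r..r}"
      then show "tube \<gamma> (s, t) \<in> tubec ` ?A"
        by (intro image_eqI[of _ _ "Complex s t"]) (auto simp: tubec_def)
    qed
    finally show "closure (Omega_r \<gamma> r) \<subseteq> tubec ` ?A" .
    fix w assume w: "w \<in> ?A"
    \<comment> \<open>The height Im w + r ranges over [0, 2 r]; height 0 is the curve itself, which
      lies in the closure but not in the open \<open>\<Omega>\<close>.\<close>
    have "?x w \<in> closure \<Omega>"
    proof (cases "Im w + r = 0")
      case True
      then have "?x w = \<gamma> (Re w)" by (simp add: tubec_eq)
      then have "?x w \<in> frontier \<Omega>" using domain(4) range_g by auto
      then show ?thesis by (simp add: frontier_def)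
    next
      case False
      have "tube \<gamma> (Re w, Im w + r) \<in> \<Omega>"
        by (rule tube_positive_inside[OF domain(1-3)])
           (use False w \<rho>(1) ccw domain(4) range_g in auto)
      then show ?thesis using closure_subset[of \<Omega>] by (auto simp: tubec_def)
    qed
    moreover have c: "?x w + of_real r * \<i> * ?v w = tubec w"
      by (simp add: tubec_eq algebra_simps)
    moreover have "sphere (tubec w) r \<inter> \<gamma> ` {0..L} \<noteq> {}"
      unfolding range_g tubec_def using sphere_meets_curve w \<rho>(1) r by auto
    ultimately have "F (tubec w) = \<Phi> (?x w) (?v w)"
      using F_def unit[of "Re w"] by (metis norm_minus_cancel)
    also have "\<dots> = ?f w"
      using \<Phi>[OF x_mem[OF w], of "?v w"] E[OF x_mem[OF w]] unit[of "Re w"] by simp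
    finally show "F (tubec w) = ?f w" .
  qed
qed

end
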